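(* Let $d=d(n)=n/2-\eta$, where $\eta=\eta(n)$ satisfies $1/2\leq\eta\leq n/64$. Then the $d$-threshold for Hamiltonicity is $\eta/n^2$. That is: (0) there exists a sequence of $n$-vertex graphs $\{H_n\}_{n\in\mathbb{N}}$ with $\delta(H_n)\geq d$ such that, if $p=o(\eta/n^2)$, then $\lim_{n\to\infty}\mathbb{P}[H_n\cup G(n,p)\text{ is Hamiltonian}]=0$; and (1) for every sequence of $n$-vertex graphs $\{H_n\}_{n\in\mathbb{N}}$ with $\delta(H_n)\geq d$, if $p=\omega(\eta/n^2)$, then $\lim_{n\to\infty}\mathbb{P}[H_n\cup G(n,p)\text{ is Hamiltonian}]=1$.
   Context: All graphs are simple. $G(n,p)$ is the binomial random graph on the same $n$-vertex set as $H_n$, obtained by including each of the $\binom{n}{2}$ possible edges independently with probability $p$; $H_n\cup G(n,p)$ is the union of the edge sets. A graph is Hamiltonian if it contains a cycle through all its vertices. $\delta(\cdot)$ denotes minimum degree. Since $d$ is an integer, $\eta$ is an integer when $n$ is even and a half-integer when $n$ is odd. Asymptotic notation is as $n\to\infty$. *)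

theory Defs
  imports "HOL-Probability.Probability" "HOL-Library.Landau_Symbols"
begin

text \<open>A simple graph is a vertex set together with a set of two-element subsets of it.\<close>

definition all_edges :: "'a set \<Rightarrow> 'a set set" where
  "all_edges V = {e. e \<subseteq> V \<and> card e = 2}"

definition simple_graph :: "'a set \<Rightarrow> 'a set set \<Rightarrow> bool" where
  "simple_graph V E \<longleftrightarrow> finite V \<and> E \<subseteq> all_edges V"

definition vertex_degree :: "'a set set \<Rightarrow> 'a \<Rightarrow> nat" where
  "vertex_degree E v = card {e \<in> E. v \<in> e}"

text \<open>Only meaningful for finite nonempty \<open>V\<close>, since \<open>Min {}\<close> is unspecified.\<close>

definition min_degree :: "'a set \<Rightarrow> 'a set set \<Rightarrow> nat" where
  "min_degree V E = Min (vertex_degree E ` V)"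

text \<open>A cycle is given by the list of its vertices in cyclic order; the index \<open>mod\<close>
  the length yields the closing edge.\<close>

definition is_cycle :: "'a set set \<Rightarrow> 'a list \<Rightarrow> bool" where
  "is_cycle E c \<longleftrightarrow> 3 \<le> length c \<and> distinct c \<and>
     (\<forall>i<length c. {c ! i, c ! (Suc i mod length c)} \<in> E)"

definition hamiltonian :: "'a set \<Rightarrow> 'a set set \<Rightarrow> bool" where
  "hamiltonian V E \<longleftrightarrow> (\<exists>c. is_cycle E c \<and> set c = V)"

text \<open>The binomial random graph (as a distribution on edge sets): one independent
  Bernoulli trial per potential edge. Only meaningful for finite \<open>V\<close> and
  \<open>0 \<le> p \<le> 1\<close>.\<close>

definition binomial_random_graph :: "'a set \<Rightarrow> real \<Rightarrow> 'a set set pmf" where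
  "binomial_random_graph V p =
     map_pmf (\<lambda>f. {e \<in> all_edges V. f e})
       (Pi_pmf (all_edges V) False (\<lambda>_. bernoulli_pmf p))"

definition prob_union_hamiltonian :: "nat \<Rightarrow> nat set set \<Rightarrow> real \<Rightarrow> real" where
  "prob_union_hamiltonian n E p =
     measure_pmf.prob (binomial_random_graph {..<n} p) {R. hamiltonian {..<n} (E \<union> R)}"

end

theory Submission
  imports Defs "HOL-Combinatorics.Cycles"
begin

text \<open>
  The lower bound is witnessed by the complete bipartite graph with parts of sizes \<open>d\<close> and
  \<open>n - d\<close>: a Hamilton cycle needs at least \<open>n - 2d = 2\<eta>\<close> random edges inside the larger part.

  For the upper bound, suppose first that \<open>H\<close> contains two disjoint sets of about \<open>d\<close> vertices
  without edges between them. Then \<open>H\<close> is almost the union of two cliques; both halves are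
  Hamilton-connected, and two disjoint random edges between them complete a Hamilton cycle.
  Otherwise extend \<open>H \<union> G(n,p)\<close> to an edge-maximal non-Hamiltonian graph \<open>F\<close>. Rotating a Hamilton
  path of \<open>F\<close> yields a cycle of length at least \<open>2d\<close>; since \<open>d\<close> is close to \<open>n/2\<close>, the vertices
  off a longest cycle are independent, and one such vertex together with the successors of its
  neighbours forms an independent set of size at least \<open>d + 1\<close> (as in Nash-Williams's theorem). All
  independent sets of \<open>H\<close> of this size meet one of at most two representatives, and those meeting a
  given representative are destroyed by a random matching of size \<open>2\<eta>\<close> inside it. Such a matching
  exists with high probability, by a union bound over the possible maximal random matchings.
\<close>

section \<open>Graphs, paths and cycles\<close>

definition nbrs :: "'a set set \<Rightarrow> 'a \<Rightarrow> 'a set" where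
  "nbrs E v = {u. {v, u} \<in> E}"

lemma in_nbrs_iff: "u \<in> nbrs E v \<longleftrightarrow> {v, u} \<in> E"
  by (simp add: nbrs_def)

lemma nbrs_mono: "E \<subseteq> F \<Longrightarrow> nbrs E v \<subseteq> nbrs F v"
  by (auto simp: nbrs_def)

lemma finite_all_edges: "finite V \<Longrightarrow> finite (all_edges V)"
  by (rule finite_subset[of _ "Pow V"]) (auto simp: all_edges_def)

lemma all_edges_mono: "V \<subseteq> W \<Longrightarrow> all_edges V \<subseteq> all_edges W"
  by (auto simp: all_edges_def)

lemma doubleton_in_all_edges_iff: "{u, v} \<in> all_edges V \<longleftrightarrow> u \<in> V \<and> v \<in> V \<and> u \<noteq> v"
  by (auto simp: all_edges_def card_insert_if)

lemma all_edgesE: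
  assumes "e \<in> all_edges V"
  obtains u v where "e = {u, v}" "u \<in> V" "v \<in> V" "u \<noteq> v"
  using assms unfolding all_edges_def card_2_iff by auto

lemma simple_graph_edge:
  assumes "simple_graph V E" "{u, v} \<in> E"
  shows "u \<in> V" "v \<in> V" "u \<noteq> v"
proof -
  have "{u, v} \<in> all_edges V" using assms by (auto simp: simple_graph_def)
  then show "u \<in> V" "v \<in> V" "u \<noteq> v" by (simp_all add: doubleton_in_all_edges_iff)
qed

lemma nbrs_subset:
  assumes "simple_graph V E"
  shows "nbrs E v \<subseteq> V - {v}"
proof
  fix u assume "u \<in> nbrs E v"
  then have "{v, u} \<in> E" by (simp add: in_nbrs_iff)
  then show "u \<in> V - {v}" using simple_graph_edge[OF assms] by blast
qed

lemma finite_nbrs: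
  assumes "simple_graph V E"
  shows "finite (nbrs E v)"
  by (rule finite_subset[OF nbrs_subset[OF assms]]) (use assms in \<open>simp add: simple_graph_def\<close>)

lemma vertex_degree_eq_card_nbrs:
  assumes "simple_graph V E"
  shows "vertex_degree E v = card (nbrs E v)"
proof -
  have "{e \<in> E. v \<in> e} = (\<lambda>u. {v, u}) ` nbrs E v"
  proof (intro equalityI subsetI)
    fix e assume incident: "e \<in> {e \<in> E. v \<in> e}"
    then have "e \<in> all_edges V" using assms by (auto simp: simple_graph_def)
    then obtain a b where "e = {a, b}" by (rule all_edgesE)
    with incident show "e \<in> (\<lambda>u. {v, u}) ` nbrs E v"
      by (auto simp: nbrs_def insert_commute)
  qed (auto simp: nbrs_def)
  moreover have "inj_on (\<lambda>u. {v, u}) (nbrs E v)"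
    by (auto simp: inj_on_def doubleton_eq_iff)
  ultimately show ?thesis by (simp add: vertex_degree_def card_image)
qed

lemma min_degree_le_card_nbrs:
  assumes "simple_graph V E" "v \<in> V"
  shows "min_degree V E \<le> card (nbrs E v)"
proof -
  have "min_degree V E \<le> vertex_degree E v"
    unfolding min_degree_def using assms by (intro Min_le) (auto simp: simple_graph_def)
  then show ?thesis using vertex_degree_eq_card_nbrs[OF assms(1)] by simp
qed

lemma min_degree_geI:
  assumes "simple_graph V E" "V \<noteq> {}" "\<And>v. v \<in> V \<Longrightarrow> d \<le> card (nbrs E v)"
  shows "d \<le> min_degree V E"
  using assms vertex_degree_eq_card_nbrs[OF assms(1)]
  by (simp add: min_degree_def simple_graph_def)

lemma min_degree_mono:
  assumes "simple_graph V F" "E \<subseteq> F" "V \<noteq> {}"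
  shows "min_degree V E \<le> min_degree V F"
proof (rule min_degree_geI[OF assms(1,3)])
  fix v assume "v \<in> V"
  have "simple_graph V E" using assms(1,2) by (auto simp: simple_graph_def)
  then have "min_degree V E \<le> card (nbrs E v)"
    using \<open>v \<in> V\<close> by (rule min_degree_le_card_nbrs)
  also have "\<dots> \<le> card (nbrs F v)"
    by (rule card_mono[OF finite_nbrs[OF assms(1)] nbrs_mono[OF assms(2)]])
  finally show "min_degree V E \<le> card (nbrs F v)" .
qed

lemma edge_maximal_supergraph:
  assumes "simple_graph V E" "\<not> Q E"
  obtains F where "E \<subseteq> F" "simple_graph V F" "\<not> Q F"
    "\<And>e. e \<in> all_edges V - F \<Longrightarrow> Q (insert e F)"
proof -
  let ?\<F> = "{F. E \<subseteq> F \<and> simple_graph V F \<and> \<not> Q F}"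
  have "finite ?\<F>"
    by (rule finite_subset[of _ "Pow (all_edges V)"])
      (use assms finite_all_edges in \<open>auto simp: simple_graph_def\<close>)
  moreover have "E \<in> ?\<F>" using assms by auto
  ultimately obtain F where admissible: "F \<in> ?\<F>" and maximal: "\<And>G. G \<in> ?\<F> \<Longrightarrow> F \<subseteq> G \<Longrightarrow> F = G"
    by (metis (no_types, lifting) finite_has_maximal2)
  have "Q (insert e F)" if "e \<in> all_edges V - F" for e
  proof (rule ccontr)
    assume "\<not> Q (insert e F)"
    then have "insert e F \<in> ?\<F>" using admissible that by (auto simp: simple_graph_def)
    then show False using maximal[of "insert e F"] that by auto
  qed
  then show ?thesis using that admissible by blast
qed

definition is_path :: "'a set set \<Rightarrow> 'a list \<Rightarrow> bool" where
  "is_path E P \<longleftrightarrow> distinct P \<and> successively (\<lambda>u v. {u, v} \<in> E) P"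

lemma is_path_append_iff:
  "is_path E (P @ Q) \<longleftrightarrow> is_path E P \<and> is_path E Q \<and> set P \<inter> set Q = {} \<and>
     (P = [] \<or> Q = [] \<or> {last P, hd Q} \<in> E)"
  by (auto simp: is_path_def successively_append_iff)

lemma is_path_rev [simp]: "is_path E (rev P) \<longleftrightarrow> is_path E P"
  by (simp add: is_path_def insert_commute)

lemma is_path_take: "is_path E P \<Longrightarrow> is_path E (take k P)"
  by (metis append_take_drop_id is_path_append_iff)

lemma is_path_drop: "is_path E P \<Longrightarrow> is_path E (drop k P)"
  by (metis append_take_drop_id is_path_append_iff)

lemma is_path_mono: "is_path E P \<Longrightarrow> E \<subseteq> F \<Longrightarrow> is_path F P"
  by (auto simp: is_path_def successively_conv_nth)

lemma is_path_complete:
  assumes "all_edges V \<subseteq> E" "distinct P" "set P \<subseteq> V"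
  shows "is_path E P"
  unfolding is_path_def successively_conv_nth
proof (intro conjI allI impI assms)
  fix i assume "Suc i < length P"
  then have "{P ! i, P ! Suc i} \<in> all_edges V"
    using assms(2,3) by (auto simp: doubleton_in_all_edges_iff nth_eq_iff_index_eq subset_iff)
  then show "{P ! i, P ! Suc i} \<in> E" using assms(1) by blast
qed

lemma is_cycle_iff_path:
  "is_cycle E c \<longleftrightarrow> 3 \<le> length c \<and> is_path E c \<and> {last c, hd c} \<in> E"
proof (cases "3 \<le> length c")
  case True
  then obtain m where length_eq: "length c = Suc m" by (cases "length c") auto
  have "(\<forall>i<length c. {c ! i, c ! (Suc i mod length c)} \<in> E) \<longleftrightarrow>
     (\<forall>i<m. {c ! i, c ! (Suc i mod Suc m)} \<in> E) \<and> {c ! m, c ! 0} \<in> E"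
    unfolding length_eq All_less_Suc by auto
  moreover have "(\<forall>i<m. {c ! i, c ! (Suc i mod Suc m)} \<in> E) \<longleftrightarrow>
     (\<forall>i. Suc i < length c \<longrightarrow> {c ! i, c ! Suc i} \<in> E)"
    unfolding length_eq by (metis Suc_less_eq mod_less)
  moreover have "last c = c ! m" "hd c = c ! 0"
    using length_eq by (auto simp: last_conv_nth hd_conv_nth simp flip: length_greater_0_conv)
  ultimately show ?thesis
    using True unfolding is_cycle_def is_path_def successively_conv_nth by auto
qed (auto simp: is_cycle_def)

lemma cycle_of_list_nth:
  assumes "distinct c" "i < length c"
  shows "cycle_of_list c (c ! i) = c ! (Suc i mod length c)"
proof -
  have "cycle_of_list c (c ! i) = map (cycle_of_list c ^^ 1) c ! i" using assms(2) by simp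
  also have "\<dots> = rotate 1 c ! i" by (simp only: cyclic_rotation[OF assms(1)])
  also have "\<dots> = c ! (Suc i mod length c)" using nth_rotate[OF assms(2), of 1] by simp
  finally show ?thesis .
qed

lemma cycle_of_list_append:
  assumes "distinct (xs @ u # v # ys)"
  shows "cycle_of_list (xs @ u # v # ys) u = v"
  using cycle_of_list_nth[OF assms, of "length xs"] by (simp add: nth_append)

lemma cycle_of_list_last:
  assumes "distinct c" "c \<noteq> []"
  shows "cycle_of_list c (last c) = hd c"
  using cycle_of_list_nth[OF assms(1), of "length c - 1"] assms(2)
  by (simp add: last_conv_nth hd_conv_nth)

lemma is_cycle_iff_cycle_of_list:
  "is_cycle E c \<longleftrightarrow> 3 \<le> length c \<and> distinct c \<and> (\<forall>v\<in>set c. {v, cycle_of_list c v} \<in> E)"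
  by (auto simp: is_cycle_def all_set_conv_all_nth cycle_of_list_nth)

lemma cycle_of_list_in_set:
  assumes "v \<in> set c"
  shows "cycle_of_list c v \<in> set c"
  using permutes_in_image[OF cycle_permutes] assms by metis

lemma inj_cycle_of_list: "inj (cycle_of_list c)"
  by (rule permutes_inj[OF cycle_permutes])

lemma cycle_of_list_no_fixpoint:
  assumes "distinct c" "2 \<le> length c" "v \<in> set c"
  shows "cycle_of_list c v \<noteq> v"
proof -
  obtain i where index: "i < length c" "v = c ! i" using assms(3) by (metis in_set_conv_nth)
  have "Suc i mod length c < length c" using index(1) by (intro mod_less_divisor) linarith
  moreover have "Suc i mod length c \<noteq> i" using index(1) assms(2) by (simp add: mod_Suc)
  ultimately show ?thesis using assms(1) index by (simp add: cycle_of_list_nth nth_eq_iff_index_eq)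
qed

lemma inj_on_cycle_edges:
  assumes "distinct c" "3 \<le> length c"
  shows "inj_on (\<lambda>v. {v, cycle_of_list c v}) (set c)"
proof (rule inj_onI)
  fix u v assume "u \<in> set c" and v_in: "v \<in> set c"
    and "{u, cycle_of_list c u} = {v, cycle_of_list c v}"
  then consider (equal) "u = v" | (involution) "cycle_of_list c (cycle_of_list c v) = v"
    by (auto simp: doubleton_eq_iff)
  then show "u = v"
  proof cases
    case involution
    let ?m = "length c"
    obtain i where index: "i < ?m" "v = c ! i" using v_in by (metis in_set_conv_nth)
    have mod_less: "k mod ?m < ?m" for k using index(1) by (intro mod_less_divisor) linarith
    have "cycle_of_list c (cycle_of_list c v) = c ! (Suc (Suc i) mod ?m)"
      using assms index mod_less by (simp add: cycle_of_list_nth mod_Suc_eq)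
    then have "Suc (Suc i) mod ?m = i"
      using involution index assms mod_less by (simp add: nth_eq_iff_index_eq)
    then show ?thesis using index(1) assms(2) by (auto simp: mod_Suc split: if_splits)
  qed
qed

lemma card_le_card_consecutive_outside:
  assumes A_subset: "A \<subseteq> set c"
  shows "card (set c) \<le> card {v \<in> set c - A. cycle_of_list c v \<in> set c - A} + 2 * card A"
proof -
  let ?succ = "cycle_of_list c"
  define T where "T = {v \<in> set c - A. ?succ v \<in> set c - A}"
  have "finite A" using A_subset by (rule finite_subset) simp
  have "?succ ` (set c - A - T) \<subseteq> A" using cycle_of_list_in_set by (auto simp: T_def)
  then have "card (set c - A - T) \<le> card A"
    using \<open>finite A\<close> by (intro card_inj_on_le[OF inj_on_subset[OF inj_cycle_of_list]]) auto
  moreover have "set c \<subseteq> T \<union> (set c - A - T) \<union> A" by blast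
  then have "card (set c) \<le> card (T \<union> (set c - A - T) \<union> A)"
    using \<open>finite A\<close> by (intro card_mono) (auto simp: T_def)
  moreover have "\<dots> \<le> card T + card (set c - A - T) + card A"
    by (meson add_le_mono1 card_Un_le le_trans)
  ultimately show ?thesis unfolding T_def by linarith
qed

lemma is_cycle_rotated_to_last:
  assumes "is_cycle E c" "v \<in> set c"
  obtains r where "is_cycle E r" "set r = set c" "length r = length c"
    "cycle_of_list r = cycle_of_list c" "last r = v" "hd r = cycle_of_list c v"
proof -
  obtain xs ys where c_split: "c = xs @ v # ys" using assms(2) by (meson split_list)
  define r where "r = rotate (Suc (length xs)) c"
  have distinct_c: "distinct c" using assms(1) by (simp add: is_cycle_def)
  have rotation: "set r = set c" "length r = length c" by (simp_all add: r_def)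
  have same_successor: "cycle_of_list r = cycle_of_list c"
    unfolding r_def by (rule cycle_of_list_rotate_independent[OF distinct_c, symmetric])
  have "r = ys @ xs @ [v]"
    using rotate_append[of "xs @ [v]" ys] by (simp add: r_def c_split del: rotate_Suc)
  then have last_r: "last r = v" by simp
  have "distinct r" "r \<noteq> []" using distinct_c by (auto simp: r_def c_split)
  then have "hd r = cycle_of_list c v" using cycle_of_list_last[of r] last_r same_successor by simp
  moreover have "is_cycle E r"
    using assms(1) \<open>distinct r\<close> rotation same_successor by (simp add: is_cycle_iff_cycle_of_list)
  ultimately show ?thesis using that rotation same_successor last_r by blast
qed

lemma is_cycle_subset:
  assumes "simple_graph V E" "is_cycle E c"
  shows "set c \<subseteq> V"
proof
  fix v assume "v \<in> set c"
  then have "{v, cycle_of_list c v} \<in> E" using assms(2) by (simp add: is_cycle_iff_cycle_of_list)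
  then show "v \<in> V" using assms(1) by (rule simple_graph_edge(1)[rotated])
qed

lemma length_cycle_le_card:
  assumes "simple_graph V E" "is_cycle E c"
  shows "length c \<le> card V"
  using card_mono[OF _ is_cycle_subset[OF assms]] assms
  by (simp add: is_cycle_def simple_graph_def distinct_card)

lemma hamiltonian_mono:
  assumes "hamiltonian V E" "E \<subseteq> F"
  shows "hamiltonian V F"
proof -
  obtain c where "is_cycle E c" "set c = V" using assms(1) by (auto simp: hamiltonian_def)
  moreover from this have "is_cycle F c" using assms(2) by (auto simp: is_cycle_def)
  ultimately show ?thesis by (auto simp: hamiltonian_def)
qed

lemma hamiltonian_complete:
  assumes "finite V" "3 \<le> card V" "all_edges V \<subseteq> E"
  shows "hamiltonian V E"
proof -
  obtain P where enumeration: "set P = V" "distinct P"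
    using finite_distinct_list[OF assms(1)] by blast
  then have long: "3 \<le> length P" using assms(2) distinct_card by metis
  then have "P \<noteq> []" by auto
  have "last P \<noteq> hd P"
    using long enumeration \<open>P \<noteq> []\<close> by (simp add: last_conv_nth hd_conv_nth nth_eq_iff_index_eq)
  then have "{last P, hd P} \<in> all_edges V"
    using \<open>P \<noteq> []\<close> enumeration(1) by (auto simp: doubleton_in_all_edges_iff)
  then have "is_cycle E P"
    using is_path_complete[OF assms(3) enumeration(2)] enumeration(1) long assms(3)
    by (auto simp: is_cycle_iff_path)
  then show ?thesis using enumeration(1) by (auto simp: hamiltonian_def)
qed

lemma hamilton_path_of_hamiltonian_insert:
  assumes "hamiltonian V (insert e F)"
  shows "\<exists>P. is_path F P \<and> set P = V"
proof -
  obtain c where cycle: "is_cycle (insert e F) c" "set c = V"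
    using assms by (auto simp: hamiltonian_def)
  let ?succ = "cycle_of_list c"
  have edge: "{v, ?succ v} \<in> insert e F" if "v \<in> set c" for v
    using cycle(1) that by (simp add: is_cycle_iff_cycle_of_list)
  have "c \<noteq> []" using cycle(1) by (auto simp: is_cycle_def)
  moreover have "inj_on (\<lambda>v. {v, ?succ v}) (set c)"
    using cycle(1) by (intro inj_on_cycle_edges) (simp_all add: is_cycle_def)
  ultimately obtain v where exceptional: "v \<in> set c" "\<And>u. u \<in> set c \<Longrightarrow> u \<noteq> v \<Longrightarrow> {u, ?succ u} \<noteq> e"
    unfolding inj_on_def by (metis hd_in_set)
  obtain r where rotation: "is_cycle (insert e F) r" "set r = set c"
    "cycle_of_list r = ?succ" "last r = v"
    using is_cycle_rotated_to_last[OF cycle(1) exceptional(1)] by metis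
  have "distinct r" using rotation(1) by (simp add: is_cycle_def)
  have "is_path F r"
    unfolding is_path_def successively_conv_nth
  proof (intro conjI allI impI)
    fix i assume i_bound: "Suc i < length r"
    then have "r \<noteq> []" by auto
    then have "r ! i \<noteq> v"
      using i_bound \<open>distinct r\<close> rotation(4) by (auto simp: last_conv_nth nth_eq_iff_index_eq)
    moreover have "?succ (r ! i) = r ! Suc i"
      using cycle_of_list_nth[OF \<open>distinct r\<close>, of i] i_bound rotation(3) by simp
    moreover have "r ! i \<in> set c" using i_bound rotation(2) by (metis Suc_lessD nth_mem)
    ultimately show "{r ! i, r ! Suc i} \<in> F" using edge exceptional(2) by fastforce
  qed (rule \<open>distinct r\<close>)
  then show ?thesis using rotation(2) cycle(2) by blast
qed

lemma nonhamiltonian_traceable_supergraph: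
  assumes "simple_graph V E" "3 \<le> card V" "\<not> hamiltonian V E"
  obtains F P where "E \<subseteq> F" "simple_graph V F" "\<not> hamiltonian V F" "is_path F P" "set P = V"
proof -
  obtain F where supergraph: "E \<subseteq> F" "simple_graph V F" "\<not> hamiltonian V F"
    "\<And>e. e \<in> all_edges V - F \<Longrightarrow> hamiltonian V (insert e F)"
    using edge_maximal_supergraph[of V E "hamiltonian V"] assms by metis
  have "\<not> all_edges V \<subseteq> F"
    using hamiltonian_complete assms(1,2) supergraph(3) by (auto simp: simple_graph_def)
  then obtain e where "hamiltonian V (insert e F)" using supergraph(4) by blast
  then obtain P where "is_path F P" "set P = V"
    using hamilton_path_of_hamiltonian_insert by blast
  then show ?thesis using that supergraph(1-3) by blast
qed

section \<open>Crossing chords of a Hamilton path\<close>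

definition separated :: "'a set set \<Rightarrow> 'a set \<Rightarrow> 'a set \<Rightarrow> bool" where
  "separated E X Y \<longleftrightarrow> X \<inter> Y = {} \<and> (\<forall>x\<in>X. \<forall>y\<in>Y. {x, y} \<notin> E)"

text \<open>The bound on \<open>Y\<close> is weaker by one because the rotation argument gives up one neighbour of
  the end vertex of the path.\<close>

definition has_separation :: "nat \<Rightarrow> 'a set \<Rightarrow> 'a set set \<Rightarrow> bool" where
  "has_separation d V E \<longleftrightarrow>
     (\<exists>X Y. X \<subseteq> V \<and> Y \<subseteq> V \<and> separated E X Y \<and> d \<le> card X \<and> d \<le> Suc (card Y))"

lemma separated_commute: "separated E X Y \<longleftrightarrow> separated E Y X"
  unfolding separated_def by (metis insert_commute inf_commute)

lemma has_separation_antimono: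
  assumes "has_separation d' V F" "d \<le> d'" "E \<subseteq> F"
  shows "has_separation d V E"
proof -
  obtain X Y where "X \<subseteq> V" "Y \<subseteq> V" "separated F X Y" "d' \<le> card X" "d' \<le> Suc (card Y)"
    using assms(1) by (auto simp: has_separation_def)
  moreover from this have "separated E X Y" using assms(3) by (auto simp: separated_def)
  ultimately show ?thesis using assms(2) unfolding has_separation_def by (meson le_trans)
qed

definition positions :: "'a list \<Rightarrow> 'a set \<Rightarrow> nat set" where
  "positions P S = {i. i < length P \<and> P ! i \<in> S}"

lemma positions_subset: "positions P S \<subseteq> {..<length P}"
  by (auto simp: positions_def)

lemma finite_positions [simp]: "finite (positions P S)"
  by (simp add: positions_def)

lemma positions_butlast: "positions (butlast P) S = {i. Suc i < length P \<and> P ! i \<in> S}"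
  by (auto simp: positions_def nth_butlast)

lemma positions_tl: "positions (tl P) S = {i. Suc i < length P \<and> P ! Suc i \<in> S}"
  by (auto simp: positions_def nth_tl)

lemma card_nth_image:
  assumes "distinct P" "I \<subseteq> {..<length P}"
  shows "card ((!) P ` I) = card I"
  using assms by (intro card_image inj_on_nth) auto

lemma card_positions:
  assumes "distinct P"
  shows "card (positions P S) = card (set P \<inter> S)"
proof -
  have "(!) P ` positions P S = set P \<inter> S"
    by (auto simp: positions_def in_set_conv_nth)
  then show ?thesis using card_nth_image[OF assms positions_subset] by metis
qed

lemma card_positions_butlast:
  assumes "distinct P" "S \<subseteq> set P"
  shows "card (positions (butlast P) S) = card (S - {last P})"
proof (cases P rule: rev_cases)
  case (snoc Q v)
  then have "set (butlast P) \<inter> S = S - {last P}" using assms by auto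
  then show ?thesis using card_positions[OF distinct_butlast[OF assms(1)]] by metis
qed (use assms in \<open>simp add: positions_def\<close>)

lemma card_positions_tl:
  assumes "distinct P" "S \<subseteq> set P"
  shows "card (positions (tl P) S) = card (S - {hd P})"
proof (cases P)
  case (Cons v Q)
  then have "set (tl P) \<inter> S = S - {hd P}" using assms by auto
  then show ?thesis using card_positions[OF distinct_tl[OF assms(1)]] by metis
qed (use assms in \<open>simp add: positions_def\<close>)

lemma card_le_Suc_card_positions:
  assumes "distinct P" "S \<subseteq> set P"
  shows "card S \<le> Suc (card (positions (butlast P) S))" "card S \<le> Suc (card (positions (tl P) S))"
proof -
  have "card S \<le> Suc (card (S - {v}))" for v using diff_card_le_card_Diff[of "{v}" S] by simp
  then show "card S \<le> Suc (card (positions (butlast P) S))"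
    "card S \<le> Suc (card (positions (tl P) S))"
    unfolding card_positions_butlast[OF assms] card_positions_tl[OF assms] by blast+
qed

text \<open>As an index into \<open>tl P\<close>, \<open>j\<close> stands for the vertex \<open>P ! Suc j\<close>.\<close>

definition crossing :: "'a set set \<Rightarrow> 'a list \<Rightarrow> nat \<Rightarrow> nat \<Rightarrow> bool" where
  "crossing E P i j \<longleftrightarrow> i \<le> j \<and>
     i \<in> positions (butlast P) (nbrs E (last P)) \<and> j \<in> positions (tl P) (nbrs E (hd P))"

lemma is_cycle_of_crossing:
  assumes path: "is_path E P" and crossing: "crossing E P i j"
    and length: "3 \<le> Suc i + (length P - Suc j)"
  shows "is_cycle E (take (Suc i) P @ rev (drop (Suc j) P))" (is "is_cycle E (?A @ rev ?B)")
proof -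
  have last_chord: "{last P, P ! i} \<in> E" and hd_chord: "{hd P, P ! Suc j} \<in> E" "Suc j < length P"
    and "i \<le> j"
    using crossing by (auto simp: crossing_def positions_butlast positions_tl in_nbrs_iff)
  have "distinct P" using path by (simp add: is_path_def)
  then have disjoint: "set ?A \<inter> set ?B = {}"
    using \<open>i \<le> j\<close> by (simp add: set_take_disj_set_drop_if_distinct)
  have nonempty: "?A \<noteq> []" "?B \<noteq> []" using hd_chord(2) by auto
  have ends_A: "hd ?A = hd P" "last ?A = P ! i" and ends_B: "hd ?B = P ! Suc j" "last ?B = last P"
    using hd_chord(2) \<open>i \<le> j\<close>
    by (simp, simp add: take_Suc_conv_app_nth, simp_all add: hd_drop_conv_nth)
  have "is_path E (?A @ rev ?B)"
    using path disjoint nonempty ends_A ends_B last_chord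
    by (auto simp: is_path_append_iff is_path_take is_path_drop hd_rev insert_commute)
  moreover have "3 \<le> length (?A @ rev ?B)" using length hd_chord(2) \<open>i \<le> j\<close> by simp
  moreover have "{last (?A @ rev ?B), hd (?A @ rev ?B)} \<in> E"
    using nonempty ends_A ends_B hd_chord(1) by (simp add: last_rev insert_commute)
  ultimately show ?thesis by (simp add: is_cycle_iff_path)
qed

lemma crossing_of_rotation:
  assumes path: "is_path E P" and pivot: "m \<in> positions (tl P) (nbrs E (hd P))"
    and last_chord: "m < i" "i \<in> positions (butlast P) (nbrs E (last P))"
    and new_chord: "i \<le> j" "Suc j < length P" "{P ! m, P ! Suc j} \<in> E"
  obtains Q where "is_path E Q" "set Q = set P" "crossing E Q i j"
proof -
  let ?A = "take (Suc m) P" and ?B = "drop (Suc m) P"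
  let ?Q = "rev ?A @ ?B"
  have pivot_edge: "Suc m < length P" "{hd P, P ! Suc m} \<in> E"
    using pivot by (auto simp: positions_tl in_nbrs_iff)
  have nonempty: "?A \<noteq> []" "?B \<noteq> []" using pivot_edge by auto
  have "distinct P" using path by (simp add: is_path_def)
  then have "set ?A \<inter> set ?B = {}" by (simp add: set_take_disj_set_drop_if_distinct)
  then have "is_path E ?Q"
    using path nonempty pivot_edge
    by (auto simp: is_path_append_iff is_path_take is_path_drop last_rev hd_drop_conv_nth)
  moreover have "set ?Q = set P" by (metis append_take_drop_id set_append set_rev)
  moreover have "crossing E ?Q i j"
  proof -
    have "hd ?Q = P ! m" "last ?Q = last P"
      using nonempty pivot_edge by (auto simp: hd_rev take_Suc_conv_app_nth)
    moreover have "?Q ! k = P ! k" if "m < k" "k < length P" for k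
      using that by (simp add: nth_append)
    ultimately show ?thesis
      using last_chord new_chord
      by (auto simp: crossing_def positions_butlast positions_tl in_nbrs_iff)
  qed
  ultimately show ?thesis using that by blast
qed

lemma obtain_adjacent_pair:
  fixes A B :: "'a :: linorder set"
  assumes finite: "finite A" "finite B" and pair: "a \<in> A" "b \<in> B" "a < b"
  obtains s t where "s \<in> A" "t \<in> B" "s < t" "{s<..<t} \<inter> (A \<union> B) = {}"
proof -
  let ?B = "{x \<in> B. a < x}"
  define t where "t = Min ?B"
  let ?A = "{x \<in> A. x < t}"
  define s where "s = Max ?A"
  have t_in: "t \<in> ?B" unfolding t_def by (rule Min_in) (use finite pair in auto)
  have s_in: "s \<in> ?A" unfolding s_def by (rule Max_in) (use finite pair t_in in auto)
  have s_greatest: "x \<le> s" if "x \<in> A" "x < t" for x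
    unfolding s_def by (rule Max_ge) (use finite that in auto)
  have t_least: "t \<le> x" if "x \<in> B" "a < x" for x
    unfolding t_def by (rule Min_le) (use finite that in auto)
  have "a \<le> s" using s_greatest pair(1) t_in by simp
  then have "{s<..<t} \<inter> (A \<union> B) = {}" using s_greatest t_least by fastforce
  then show ?thesis using that[of s t] s_in t_in by blast
qed

locale hamilton_path =
  fixes V :: "'a set" and E :: "'a set set" and P :: "'a list"
  assumes simple: "simple_graph V E" and path: "is_path E P" and spanning: "set P = V"
    and nonempty: "P \<noteq> []"
begin

abbreviation last_nbrs :: "nat set" where
  "last_nbrs \<equiv> positions (butlast P) (nbrs E (last P))"

abbreviation hd_nbrs :: "nat set" where
  "hd_nbrs \<equiv> positions (tl P) (nbrs E (hd P))"

lemma distinct: "distinct P"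
  using path by (simp add: is_path_def)

lemma nbrs_minus_self: "nbrs E v - {v} = nbrs E v"
  using nbrs_subset[OF simple, of v] by blast

lemma nbrs_subset_path: "nbrs E v \<subseteq> set P"
  using nbrs_subset[OF simple, of v] spanning by blast

lemma card_last_nbrs: "min_degree V E \<le> card last_nbrs"
  using card_positions_butlast[OF distinct nbrs_subset_path] nbrs_minus_self[of "last P"]
    min_degree_le_card_nbrs[OF simple, of "last P"] nonempty spanning by auto

lemma card_hd_nbrs: "min_degree V E \<le> card hd_nbrs"
  using card_positions_tl[OF distinct nbrs_subset_path] nbrs_minus_self[of "hd P"]
    min_degree_le_card_nbrs[OF simple, of "hd P"] nonempty spanning by auto

lemma last_nbrs_subset: "last_nbrs \<subseteq> {..<length P - 1}"
  and hd_nbrs_subset: "hd_nbrs \<subseteq> {..<length P - 1}"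
  using positions_subset[of "butlast P"] positions_subset[of "tl P"] by auto

lemma hamiltonian_of_tight_crossing:
  assumes "3 \<le> length P" "crossing E P i i"
  shows "hamiltonian V E"
proof -
  have "is_cycle E (take (Suc i) P @ rev (drop (Suc i) P))"
    using assms by (intro is_cycle_of_crossing[OF path]) auto
  moreover have "set (take (Suc i) P @ rev (drop (Suc i) P)) = V"
    using spanning by (metis append_take_drop_id set_append set_rev)
  ultimately show ?thesis unfolding hamiltonian_def by blast
qed

lemma long_cycle_of_crossing:
  assumes degree: "2 \<le> min_degree V E" and nonham: "\<not> hamiltonian V E"
    and crossing: "crossing E P i\<^sub>0 j\<^sub>0"
  shows "\<exists>c. is_cycle E c \<and> 2 * min_degree V E \<le> length c"
proof -
  have "min_degree V E \<le> length P - 1"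
    using card_last_nbrs card_mono[OF _ last_nbrs_subset] by simp
  then have length: "3 \<le> length P" using degree by linarith
  have disjoint: "last_nbrs \<inter> hd_nbrs = {}"
    using hamiltonian_of_tight_crossing[OF length] nonham by (auto simp: crossing_def)
  have "i\<^sub>0 \<in> last_nbrs" "j\<^sub>0 \<in> hd_nbrs" "i\<^sub>0 < j\<^sub>0"
    using crossing disjoint by (auto simp: crossing_def order_le_less)
  then obtain i j where i_in: "i \<in> last_nbrs" and j_in: "j \<in> hd_nbrs" and "i < j"
    and gap: "{i<..<j} \<inter> (last_nbrs \<union> hd_nbrs) = {}"
    by (rule obtain_adjacent_pair[OF finite_positions finite_positions])
  have "card {i<..<j} + (card last_nbrs + card hd_nbrs) = card ({i<..<j} \<union> (last_nbrs \<union> hd_nbrs))"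
    using gap disjoint by (simp add: card_Un_disjoint)
  also have "\<dots> \<le> card {..<length P - 1}"
    using j_in last_nbrs_subset hd_nbrs_subset by (intro card_mono) auto
  finally have "(j - Suc i) + 2 * min_degree V E \<le> length P - 1"
    using card_last_nbrs card_hd_nbrs by simp
  then have long: "2 * min_degree V E \<le> Suc i + (length P - Suc j)" using \<open>i < j\<close> by linarith
  have "crossing E P i j" using i_in j_in \<open>i < j\<close> by (simp add: crossing_def)
  then have "is_cycle E (take (Suc i) P @ rev (drop (Suc j) P))"
    using long degree by (intro is_cycle_of_crossing[OF path]) auto
  moreover have "2 * min_degree V E \<le> length (take (Suc i) P @ rev (drop (Suc j) P))"
    using long \<open>i < j\<close> j_in hd_nbrs_subset by (auto simp: min_def)
  ultimately show ?thesis by blast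
qed

text \<open>Every predecessor on \<open>P\<close> of a neighbour of \<open>hd P\<close> starts a rotated path with the same end,
  so the absence of crossing chords applies to all of them at once.\<close>

lemma separation_of_no_crossing:
  assumes degree: "1 \<le> min_degree V E"
    and no_crossing: "\<And>Q i j. is_path E Q \<Longrightarrow> set Q = V \<Longrightarrow> \<not> crossing E Q i j"
  shows "has_separation (min_degree V E) V E"
proof -
  define first where "first = Min last_nbrs"
  have first: "first \<in> last_nbrs" "\<And>i. i \<in> last_nbrs \<Longrightarrow> first \<le> i"
    using card_last_nbrs degree by (auto simp: first_def intro!: Min_in)
  have before_first: "j < first" if "j \<in> hd_nbrs" for j
    using no_crossing[OF path spanning, of first j] that first(1) by (simp add: crossing_def)
  let ?X = "(!) P ` hd_nbrs" and ?Y = "(!) P ` (last_nbrs - {first})"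
  have index_sets: "hd_nbrs \<subseteq> {..<length P}" "last_nbrs - {first} \<subseteq> {..<length P}"
    using hd_nbrs_subset last_nbrs_subset by auto
  have "?X \<subseteq> V" "?Y \<subseteq> V" using index_sets spanning by auto
  moreover have "min_degree V E \<le> card ?X"
    using card_hd_nbrs card_nth_image[OF distinct index_sets(1)] by simp
  moreover have "min_degree V E \<le> Suc (card ?Y)"
    using card_last_nbrs card_nth_image[OF distinct index_sets(2)] first(1)
    by (simp add: card_Diff_singleton)
  moreover have "P ! j \<noteq> P ! i \<and> {P ! j, P ! i} \<notin> E"
    if j_in: "j \<in> hd_nbrs" and i_in: "i \<in> last_nbrs - {first}" for i j
  proof
    obtain k where predecessor: "i = Suc k" "first \<le> k" using first(2)[of i] i_in by (cases i) auto
    have "i < length P" using index_sets(2) i_in by auto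
    then show "P ! j \<noteq> P ! i"
      using before_first[OF j_in] predecessor by (simp add: nth_eq_iff_index_eq[OF distinct])
    show "{P ! j, P ! i} \<notin> E"
    proof
      assume "{P ! j, P ! i} \<in> E"
      with \<open>i < length P\<close> obtain Q where "is_path E Q" "set Q = set P" "crossing E Q first k"
        unfolding predecessor(1)
        by (rule crossing_of_rotation[OF path j_in before_first[OF j_in] first(1) predecessor(2)])
      then show False using no_crossing spanning by blast
    qed
  qed
  then have "separated E ?X ?Y" by (auto simp: separated_def)
  ultimately show ?thesis unfolding has_separation_def by blast
qed

end

section \<open>Longest cycles\<close>

definition independent_set :: "'a set set \<Rightarrow> 'a set \<Rightarrow> bool" where
  "independent_set E I \<longleftrightarrow> (\<forall>u\<in>I. \<forall>v\<in>I. {u, v} \<notin> E)"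

lemma independent_set_antimono: "independent_set F I \<Longrightarrow> E \<subseteq> F \<Longrightarrow> independent_set E I"
  by (auto simp: independent_set_def)

locale longest_cycle =
  fixes V :: "'a set" and E :: "'a set set" and c :: "'a list"
  assumes simple: "simple_graph V E" and cycle: "is_cycle E c"
    and longest: "\<And>c'. is_cycle E c' \<Longrightarrow> length c' \<le> length c"
begin

abbreviation succ :: "'a \<Rightarrow> 'a" where
  "succ \<equiv> cycle_of_list c"

lemma length_ge_3: "3 \<le> length c" and distinct: "distinct c" and subset: "set c \<subseteq> V"
  using cycle is_cycle_subset[OF simple] by (auto simp: is_cycle_def)

lemma finite_vertices: "finite V"
  using simple by (simp add: simple_graph_def)

text \<open>Otherwise inserting the path \<open>Q\<close> between \<open>v\<close> and its successor yields a longer cycle.\<close>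

lemma no_detour:
  assumes on_cycle: "v \<in> set c" and detour: "is_path E Q" "Q \<noteq> []" "set Q \<inter> set c = {}"
    and attached: "{v, hd Q} \<in> E"
  shows "{last Q, succ v} \<notin> E"
proof
  assume "{last Q, succ v} \<in> E"
  obtain r where rotation: "is_cycle E r" "set r = set c" "length r = length c" "last r = v"
    "hd r = succ v"
    using is_cycle_rotated_to_last[OF cycle on_cycle] by metis
  have "is_path E r" "r \<noteq> []" using rotation(1) by (auto simp: is_cycle_iff_path)
  then have "is_path E (r @ Q)"
    using detour attached rotation(2,4) by (auto simp: is_path_append_iff)
  then have "is_cycle E (r @ Q)"
    using \<open>{last Q, succ v} \<in> E\<close> \<open>r \<noteq> []\<close> detour(2) rotation(3,5) length_ge_3
    by (simp add: is_cycle_iff_path)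
  then have "length (r @ Q) \<le> length c" by (rule longest)
  then show False using rotation(3) detour(2) by simp
qed

text \<open>Here the path \<open>x, y\<close> replaces the single vertex \<open>succ v\<close>.\<close>

lemma no_exchange:
  assumes on_cycle: "v \<in> set c" and off_cycle: "x \<notin> set c" "y \<notin> set c"
    and edge: "{x, y} \<in> E" and attached: "{v, x} \<in> E"
  shows "{y, succ (succ v)} \<notin> E"
proof
  assume closing: "{y, succ (succ v)} \<in> E"
  obtain r where rotation: "is_cycle E r" "set r = set c" "length r = length c" "last r = v"
    "hd r = succ v" "cycle_of_list r = succ"
    using is_cycle_rotated_to_last[OF cycle on_cycle] by metis
  obtain a b l where r_eq: "r = a # b # l" and "l \<noteq> []"
    using rotation(3) length_ge_3 by (cases r; cases "tl r"; cases "tl (tl r)") auto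
  have "distinct r" using rotation(1) by (simp add: is_cycle_def)
  then have "succ a = b"
    using cycle_of_list_append[of "[]" a b l] unfolding rotation(6)[symmetric] r_eq by simp
  then have b_eq: "b = succ (succ v)" using rotation(5) by (simp add: r_eq)
  have "x \<noteq> y" using simple_graph_edge(3)[OF simple edge] .
  then have "is_path E [x, y]" using edge by (simp add: is_path_def)
  moreover have "is_path E (b # l)"
    using rotation(1) is_path_append_iff[of E "[a]" "b # l"] by (simp add: r_eq is_cycle_iff_path)
  moreover have "last (b # l) = v" "set (b # l) \<subseteq> set c"
    using rotation(2,4) \<open>l \<noteq> []\<close> by (auto simp: r_eq)
  ultimately have "is_path E ((b # l) @ [x, y])"
    using off_cycle attached unfolding is_path_append_iff by auto
  then have "is_cycle E ((b # l) @ [x, y])"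
    using closing b_eq length_ge_3 rotation(3) r_eq by (simp add: is_cycle_iff_path)
  then show False using longest[of "(b # l) @ [x, y]"] rotation(3) by (simp add: r_eq)
qed

lemma succ_nbrs_disjoint:
  assumes "x \<notin> set c" "y \<notin> set c" "x = y \<or> {x, y} \<in> E"
  shows "succ ` (nbrs E x \<inter> set c) \<inter> nbrs E y = {}"
proof (rule ccontr)
  assume "\<not> ?thesis"
  then obtain v where chords: "v \<in> set c" "{v, x} \<in> E" "{y, succ v} \<in> E"
    by (auto simp: in_nbrs_iff insert_commute)
  show False
  proof (cases "x = y")
    case True
    then show False using no_detour[of v "[x]"] chords assms(1) by (simp add: is_path_def)
  next
    case False
    then have "is_path E [x, y]" using assms(3) by (simp add: is_path_def)
    then show False using no_detour[of v "[x, y]"] chords assms(1,2) by simp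
  qed
qed

lemma succ_succ_nbrs_disjoint:
  assumes "x \<notin> set c" "y \<notin> set c" "{x, y} \<in> E"
  shows "succ ` succ ` (nbrs E x \<inter> set c) \<inter> nbrs E y = {}"
  using no_exchange[OF _ assms] by (auto simp: in_nbrs_iff insert_commute)

lemma card_nbrs_on_cycle:
  assumes "x \<in> V"
  shows "min_degree V E + length c \<le> card (nbrs E x \<inter> set c) + card V"
proof -
  have "card (nbrs E x) \<le> card (nbrs E x \<inter> set c) + card (V - set c)"
  proof -
    have "nbrs E x \<subseteq> (nbrs E x \<inter> set c) \<union> (V - set c)" using nbrs_subset[OF simple] by blast
    then have "card (nbrs E x) \<le> card ((nbrs E x \<inter> set c) \<union> (V - set c))"
      using finite_vertices by (intro card_mono) auto
    then show ?thesis using card_Un_le le_trans by blast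
  qed
  moreover have "card (V - set c) + length c = card V"
    using card_Diff_subset[OF _ subset] card_mono[OF finite_vertices subset]
      distinct_card[OF distinct] by simp
  ultimately show ?thesis using min_degree_le_card_nbrs[OF simple assms] by linarith
qed

text \<open>If \<open>x\<close> and \<open>y\<close> off the cycle were adjacent, the neighbours of \<open>y\<close> on the cycle together with
  the first and the second successors of the neighbours of \<open>x\<close> would be too many.\<close>

lemma independent_off_cycle:
  assumes long: "3 * card V < 3 * min_degree V E + 2 * length c"
  shows "independent_set E (V - set c)"
  unfolding independent_set_def
proof (intro ballI notI)
  fix x y assume x_off: "x \<in> V - set c" and y_off: "y \<in> V - set c" and edge: "{x, y} \<in> E"
  let ?X = "nbrs E x \<inter> set c" and ?Y = "nbrs E y \<inter> set c"
  let ?S = "succ ` ?X" and ?SS = "succ ` succ ` ?X"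
  have inj_succ: "inj_on succ A" for A using inj_cycle_of_list by (rule inj_on_subset) simp
  have "?S \<inter> ?X = {}" using succ_nbrs_disjoint[of x x] x_off by auto
  then have "?S \<inter> ?SS = {}" using image_Int[OF inj_cycle_of_list, of c ?X ?S] by auto
  moreover have "(?S \<union> ?SS) \<inter> ?Y = {}"
    using succ_nbrs_disjoint[of x y] succ_succ_nbrs_disjoint[OF _ _ edge] x_off y_off edge by blast
  ultimately have "card ((?S \<union> ?SS) \<union> ?Y) = card ?S + card ?SS + card ?Y"
    by (simp add: card_Un_disjoint)
  moreover have "(?S \<union> ?SS) \<union> ?Y \<subseteq> set c" using cycle_of_list_in_set[of _ c] by auto
  then have "card ((?S \<union> ?SS) \<union> ?Y) \<le> length c"
    using card_mono[OF finite_set] distinct_card[OF distinct] by metis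
  moreover have "card ?S = card ?X" "card ?SS = card ?X" by (simp_all add: card_image inj_succ)
  ultimately have "2 * card ?X + card ?Y \<le> length c" by linarith
  moreover have "length c \<le> card V" by (rule length_cycle_le_card[OF simple cycle])
  ultimately show False
    using long card_nbrs_on_cycle[of x] card_nbrs_on_cycle[of y] x_off y_off by simp
qed

text \<open>Reversing the segment of the cycle from \<open>succ u\<close> to \<open>w\<close> would make room for \<open>x\<close> between
  \<open>u\<close> and \<open>w\<close>.\<close>

lemma no_edge_between_successors:
  assumes off_cycle: "x \<notin> set c" and u_nbr: "u \<in> set c" "{u, x} \<in> E"
    and w_nbr: "w \<in> set c" "{w, x} \<in> E"
    and "u \<noteq> w"
  shows "{succ u, succ w} \<notin> E"
proof
  assume edge: "{succ u, succ w} \<in> E"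
  obtain r where rotation: "is_cycle E r" "set r = set c" "length r = length c" "last r = u"
    "hd r = succ u" "cycle_of_list r = succ"
    using is_cycle_rotated_to_last[OF cycle u_nbr(1)] by metis
  obtain A B where r_split: "r = A @ w # B" using w_nbr(1) rotation(2) by (metis split_list)
  then obtain b B' where B_eq: "B = b # B'" using rotation(4) \<open>u \<noteq> w\<close> by (cases B) auto
  define A' where "A' = A @ [w]"
  have r_eq: "r = A' @ B" and last_A': "A' \<noteq> []" "last A' = w" by (simp_all add: A'_def r_split)
  have "distinct r" using rotation(1) by (simp add: is_cycle_def)
  then have "hd B = succ w"
    using cycle_of_list_append[of A w b B'] rotation(6) by (simp add: r_split B_eq)
  moreover have "B \<noteq> []" by (simp add: B_eq)
  moreover have ends: "hd A' = succ u" "last B = u"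
    using rotation(4,5) last_A' \<open>B \<noteq> []\<close> by (auto simp: r_eq)
  moreover have "is_path E A'" "is_path E B" "set A' \<inter> set B = {}"
    using rotation(1) by (auto simp: r_eq is_cycle_iff_path is_path_append_iff)
  ultimately have "is_path E (rev A' @ B)"
    using edge last_A' by (simp add: is_path_append_iff last_rev)
  moreover have "set (rev A' @ B) = set c" using rotation(2) by (simp add: r_eq)
  moreover have "is_path E [x]" by (simp add: is_path_def)
  ultimately have "is_path E ((rev A' @ B) @ [x])"
    using u_nbr(2) off_cycle ends(2) \<open>B \<noteq> []\<close>
    unfolding is_path_append_iff[of E "rev A' @ B"] by simp
  moreover have "length (rev A' @ B) = length c" using rotation(3) by (simp add: r_eq)
  ultimately have "is_cycle E ((rev A' @ B) @ [x])"
    using last_A' w_nbr(2) length_ge_3 by (simp add: is_cycle_iff_path hd_rev insert_commute)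
  then have "length ((rev A' @ B) @ [x]) \<le> length c" by (rule longest)
  then show False using \<open>length (rev A' @ B) = length c\<close> by simp
qed

lemma independent_successors:
  assumes off_cycle: "x \<in> V - set c" and nbrs: "nbrs E x \<subseteq> set c"
  shows "\<exists>I\<subseteq>V. independent_set E I \<and> card I = Suc (card (nbrs E x))"
proof (intro exI conjI)
  let ?S = "succ ` nbrs E x"
  have "?S \<subseteq> set c" using nbrs cycle_of_list_in_set by fast
  then show "insert x ?S \<subseteq> V" using off_cycle subset by blast
  have "card ?S = card (nbrs E x)"
    by (intro card_image inj_on_subset[OF inj_cycle_of_list]) simp
  moreover have "x \<notin> ?S" "finite ?S" using \<open>?S \<subseteq> set c\<close> off_cycle finite_nbrs[OF simple] by auto
  ultimately show "card (insert x ?S) = Suc (card (nbrs E x))" by simp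
  have irrefl: "{v, v} \<notin> E" for v using simple_graph_edge(3)[OF simple, of v v] by blast
  have "{x, s} \<notin> E" if "s \<in> ?S" for s
    using succ_nbrs_disjoint[of x x] off_cycle nbrs that
    by (simp add: Int_absorb2 disjoint_iff flip: in_nbrs_iff)
  moreover from this have "{s, x} \<notin> E" if "s \<in> ?S" for s
    using that by (simp add: insert_commute)
  moreover have "{succ u, succ w} \<notin> E" if "u \<in> nbrs E x" "w \<in> nbrs E x" for u w
  proof (cases "u = w")
    case False
    have "u \<in> set c" "w \<in> set c" using that nbrs by auto
    moreover have "{u, x} \<in> E" "{w, x} \<in> E" using that by (simp_all add: in_nbrs_iff insert_commute)
    ultimately show ?thesis using no_edge_between_successors[of x u w] False off_cycle by simp
  next
    case True
    then show ?thesis using irrefl by simp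
  qed
  ultimately show "independent_set E (insert x ?S)"
    using irrefl unfolding independent_set_def by blast
qed

end

lemma obtain_longest_cycle:
  assumes "simple_graph V E" "is_cycle E c\<^sub>0"
  obtains c where "longest_cycle V E c"
proof -
  have "length c < Suc (card V)" if "is_cycle E c" for c
    using length_cycle_le_card[OF assms(1) that] by simp
  then obtain c where "is_cycle E c" "\<And>c'. is_cycle E c' \<Longrightarrow> length c' \<le> length c"
    using ex_has_greatest_nat[of "is_cycle E" c\<^sub>0 length] assms(2) by metis
  then have "longest_cycle V E c" using assms(1) by unfold_locales
  then show ?thesis by (rule that)
qed

lemma large_independent_set_of_long_cycle:
  assumes simple: "simple_graph V E" and nonham: "\<not> hamiltonian V E"
    and long_cycle: "is_cycle E c\<^sub>0" "3 * card V < 3 * min_degree V E + 2 * length c\<^sub>0"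
  shows "\<exists>I\<subseteq>V. independent_set E I \<and> min_degree V E < card I"
proof -
  obtain c where longest_cycle: "longest_cycle V E c"
    using obtain_longest_cycle[OF simple long_cycle(1)] .
  interpret longest_cycle V E c by (rule longest_cycle)
  have independent_off: "independent_set E (V - set c)"
    using longest[OF long_cycle(1)] long_cycle(2) by (intro independent_off_cycle) linarith
  have "set c \<noteq> V" using cycle nonham by (auto simp: hamiltonian_def)
  then obtain x where x_off: "x \<in> V - set c" using subset by blast
  have "nbrs E x \<subseteq> set c"
    using nbrs_subset[OF simple, of x] independent_off x_off
    by (auto simp: independent_set_def in_nbrs_iff)
  then obtain I where "I \<subseteq> V" "independent_set E I" "card I = Suc (card (nbrs E x))"
    using independent_successors[OF x_off] by blast
  then show ?thesis
    using min_degree_le_card_nbrs[OF simple, of x] x_off by (auto simp: less_Suc_eq_le)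
qed

lemma long_cycle_or_separation:
  assumes simple: "simple_graph V E" and nonham: "\<not> hamiltonian V E"
    and ham_path: "is_path E P" "set P = V" "V \<noteq> {}" and degree: "2 \<le> min_degree V E"
  shows "(\<exists>c. is_cycle E c \<and> 2 * min_degree V E \<le> length c) \<or> has_separation (min_degree V E) V E"
proof (cases "\<exists>Q i j. is_path E Q \<and> set Q = V \<and> crossing E Q i j")
  case True
  then obtain Q i j where crossing_path: "is_path E Q" "set Q = V" "crossing E Q i j" by blast
  interpret hamilton_path V E Q using simple crossing_path(1,2) ham_path(3) by unfold_locales auto
  show ?thesis using long_cycle_of_crossing[OF degree nonham crossing_path(3)] by blast
next
  case False
  interpret hamilton_path V E P using simple ham_path by unfold_locales auto
  show ?thesis using separation_of_no_crossing False degree by auto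
qed

theorem hamiltonian_of_small_independent_sets:
  assumes simple: "simple_graph V E" and card: "3 \<le> card V"
    and degree: "3 * card V < 7 * min_degree V E"
    and no_separation: "\<not> has_separation (min_degree V E) V E"
    and independent: "\<And>I. I \<subseteq> V \<Longrightarrow> independent_set E I \<Longrightarrow> card I \<le> min_degree V E"
  shows "hamiltonian V E"
proof (rule ccontr)
  assume "\<not> hamiltonian V E"
  then obtain F P where supergraph: "E \<subseteq> F" "simple_graph V F" "\<not> hamiltonian V F"
    and ham_path: "is_path F P" "set P = V"
    using nonhamiltonian_traceable_supergraph[OF simple card] by metis
  have mono: "min_degree V E \<le> min_degree V F"
    using card by (intro min_degree_mono[OF supergraph(2,1)]) auto
  have "\<not> has_separation (min_degree V F) V F"
    using has_separation_antimono[OF _ mono supergraph(1)] no_separation by blast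
  moreover have "2 \<le> min_degree V F" using card degree mono by linarith
  ultimately obtain c where long_cycle: "is_cycle F c" "2 * min_degree V F \<le> length c"
    using long_cycle_or_separation[OF supergraph(2,3) ham_path] card by fastforce
  then obtain I where large_set: "I \<subseteq> V" "independent_set F I" "min_degree V F < card I"
    using large_independent_set_of_long_cycle[OF supergraph(2,3) long_cycle(1)] degree mono by auto
  have "independent_set E I" using large_set(2) supergraph(1) by (rule independent_set_antimono)
  then have "card I \<le> min_degree V E" by (rule independent[OF large_set(1)])
  then show False using large_set(3) mono by linarith
qed

section \<open>Hamilton-connected sets\<close>

definition spanning_path :: "'a set \<Rightarrow> 'a set set \<Rightarrow> 'a \<Rightarrow> 'a \<Rightarrow> bool" where
  "spanning_path A E a b \<longleftrightarrow> (\<exists>P. is_path E P \<and> set P = A \<and> hd P = a \<and> last P = b)"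

definition hamilton_connected :: "'a set \<Rightarrow> 'a set set \<Rightarrow> bool" where
  "hamilton_connected A E \<longleftrightarrow> (\<forall>a\<in>A. \<forall>b\<in>A. a \<noteq> b \<longrightarrow> spanning_path A E a b)"

lemma spanning_path_mono: "spanning_path A E a b \<Longrightarrow> E \<subseteq> F \<Longrightarrow> spanning_path A F a b"
  unfolding spanning_path_def using is_path_mono by blast

lemma hamilton_connected_mono: "hamilton_connected A E \<Longrightarrow> E \<subseteq> F \<Longrightarrow> hamilton_connected A F"
  unfolding hamilton_connected_def using spanning_path_mono by metis

lemma spanning_path_complete:
  assumes "finite A" "all_edges A \<subseteq> E" "a \<in> A" "b \<in> A" "a \<noteq> b"
  shows "spanning_path A E a b"
proof -
  obtain L where interior: "set L = A - {a, b}" "distinct L"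
    using finite_distinct_list[of "A - {a, b}"] assms(1) by blast
  then have "is_path E (a # L @ [b])"
    using assms by (intro is_path_complete[OF assms(2)]) auto
  then show ?thesis
    unfolding spanning_path_def using interior assms by (intro exI[of _ "a # L @ [b]"]) auto
qed

lemma spanning_path_switch:
  assumes distinct: "distinct P" and order: "s < t" "Suc t < length P"
    and edge: "\<And>i. Suc i < length P \<Longrightarrow> i \<noteq> s \<Longrightarrow> i \<noteq> t \<Longrightarrow> {P ! i, P ! Suc i} \<in> E"
    and chords: "{P ! s, P ! t} \<in> E" "{P ! Suc s, P ! Suc t} \<in> E"
  shows "spanning_path (set P) E (hd P) (last P)"
proof -
  define X where "X = take (Suc s) P"
  define Y where "Y = drop (Suc s) (take (Suc t) P)"
  define Z where "Z = drop (Suc t) P"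
  have "take (Suc t) P = X @ Y"
    unfolding X_def Y_def using append_take_drop_id[of "Suc s" "take (Suc t) P"] order(1)
    by (simp add: min_def)
  then have P_split: "P = X @ Y @ Z" unfolding Z_def by (metis append_assoc append_take_drop_id)
  have nonempty: "X \<noteq> []" "Y \<noteq> []" "Z \<noteq> []" using order by (auto simp: X_def Y_def Z_def)
  have "is_path E X" "is_path E Y" "is_path E Z"
    using distinct edge order by (auto simp: X_def Y_def Z_def is_path_def successively_conv_nth)
  moreover have "last X = P ! s" using order by (simp add: X_def take_Suc_conv_app_nth)
  moreover have "hd Y = P ! Suc s" "last Y = P ! t" "hd Z = P ! Suc t"
    using order by (simp_all add: Y_def Z_def hd_drop_conv_nth last_conv_nth)
  moreover have "set X \<inter> set Y = {}" "set X \<inter> set Z = {}" "set Y \<inter> set Z = {}"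
    using distinct unfolding P_split by auto
  ultimately have "is_path E (X @ rev Y @ Z)"
    using nonempty chords by (auto simp: is_path_append_iff hd_rev last_rev)
  moreover have "set (X @ rev Y @ Z) = set P" unfolding P_split by simp
  moreover have "hd (X @ rev Y @ Z) = hd P" "last (X @ rev Y @ Z) = last P"
    unfolding P_split using nonempty by simp_all
  ultimately show ?thesis unfolding spanning_path_def by blast
qed

lemma spanning_path_exchange:
  assumes distinct: "distinct P" and "s \<noteq> t" and bounds: "Suc s < length P" "Suc t < length P"
    and edge: "\<And>i. Suc i < length P \<Longrightarrow> i \<noteq> s \<Longrightarrow> {P ! i, P ! Suc i} \<in> E"
    and chords: "{P ! s, P ! t} \<in> E" "{P ! Suc s, P ! Suc t} \<in> E"
  shows "spanning_path (set P) E (hd P) (last P)"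
proof (cases s t rule: linorder_cases)
  case less
  then show ?thesis using bounds chords edge by (intro spanning_path_switch[OF distinct])
next
  case greater
  then show ?thesis
    using bounds chords edge
    by (intro spanning_path_switch[OF distinct, of t s]) (simp_all add: insert_commute)
qed (use \<open>s \<noteq> t\<close> in simp)

lemma spanning_path_insertE:
  assumes "spanning_path A (insert e E) a b" "\<not> spanning_path A E a b"
  obtains P s where "distinct P" "set P = A" "hd P = a" "last P = b"
    "Suc s < length P" "{P ! s, P ! Suc s} = e"
    "\<And>i. Suc i < length P \<Longrightarrow> i \<noteq> s \<Longrightarrow> {P ! i, P ! Suc i} \<in> E"
proof -
  obtain P where spanning: "is_path (insert e E) P" "set P = A" "hd P = a" "last P = b"
    using assms(1) unfolding spanning_path_def by blast
  have distinct: "distinct P" using spanning(1) by (simp add: is_path_def)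
  have "\<not> is_path E P" using assms(2) spanning(2-4) unfolding spanning_path_def by blast
  then obtain s where new_edge: "Suc s < length P" "{P ! s, P ! Suc s} = e"
    using spanning(1) unfolding is_path_def successively_conv_nth by blast
  have "{P ! i, P ! Suc i} \<in> E" if other: "Suc i < length P" "i \<noteq> s" for i
  proof -
    have "{P ! i, P ! Suc i} \<noteq> e"
      using other new_edge distinct by (auto simp: doubleton_eq_iff nth_eq_iff_index_eq)
    then show ?thesis using spanning(1) other(1) unfolding is_path_def successively_conv_nth by auto
  qed
  then show ?thesis using that distinct spanning(2-4) new_edge by blast
qed

lemma ore_degree_sum:
  assumes simple: "simple_graph A E" and path: "spanning_path A (insert {u, v} E) a b"
    and no_path: "\<not> spanning_path A E a b"
  shows "card (nbrs E u) + card (nbrs E v) \<le> card A"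
proof -
  obtain P s where distinct: "distinct P" and spanning: "set P = A" "hd P = a" "last P = b"
    and new_edge: "Suc s < length P" "{P ! s, P ! Suc s} = {u, v}"
    and edge: "\<And>i. Suc i < length P \<Longrightarrow> i \<noteq> s \<Longrightarrow> {P ! i, P ! Suc i} \<in> E"
    using spanning_path_insertE[OF path no_path] by metis
  let ?X = "positions (butlast P) (nbrs E (P ! s))" and ?Y = "positions (tl P) (nbrs E (P ! Suc s))"
  have "w \<notin> nbrs E w" for w using nbrs_subset[OF simple, of w] by auto
  then have s_notin: "s \<notin> ?X" "s \<notin> ?Y" by (auto simp: positions_butlast positions_tl)
  have "?X \<inter> ?Y = {}"
  proof (rule ccontr)
    assume "?X \<inter> ?Y \<noteq> {}"
    then obtain t where "t \<in> ?X" "t \<in> ?Y" by auto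
    then have chords: "Suc t < length P" "{P ! s, P ! t} \<in> E" "{P ! Suc s, P ! Suc t} \<in> E"
      by (auto simp: positions_butlast positions_tl in_nbrs_iff)
    have "s \<noteq> t" using \<open>t \<in> ?X\<close> s_notin by blast
    then have "spanning_path (set P) E (hd P) (last P)"
      using new_edge(1) chords edge by (intro spanning_path_exchange[OF distinct])
    then show False using no_path spanning by simp
  qed
  then have "card ?X + card ?Y = card (?X \<union> ?Y)" by (simp add: card_Un_disjoint)
  also have "\<dots> \<le> card ({..<length P - 1} - {s})"
    using positions_subset[of "butlast P"] positions_subset[of "tl P"] s_notin
    by (intro card_mono) auto
  also have "\<dots> = length P - 2" using new_edge(1) by (simp add: card_Diff_singleton)
  finally have "card ?X + card ?Y \<le> length P - 2" .
  moreover have "nbrs E w \<subseteq> set P" for w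
    using nbrs_subset[OF simple, of w] spanning(1) by blast
  then have "card (nbrs E (P ! s)) \<le> Suc (card ?X)" "card (nbrs E (P ! Suc s)) \<le> Suc (card ?Y)"
    by (simp_all add: card_le_Suc_card_positions[OF distinct])
  ultimately have "card (nbrs E (P ! s)) + card (nbrs E (P ! Suc s)) \<le> card A"
    using new_edge(1) distinct_card[OF distinct] unfolding spanning(1) by linarith
  then show ?thesis using new_edge(2) by (auto simp: doubleton_eq_iff)
qed

lemma complete_of_ore_closed:
  assumes simple: "simple_graph A E" and S_subset: "S \<subseteq> A"
    and closed: "\<And>u v. \<lbrakk>u \<in> A; v \<in> A; u \<noteq> v; card A < card (nbrs E u) + card (nbrs E v)\<rbrakk>
      \<Longrightarrow> {u, v} \<in> E"
    and degree_S: "\<And>x. x \<in> S \<Longrightarrow> card A < 2 * card (nbrs E x)"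
    and degree_A: "\<And>r. r \<in> A \<Longrightarrow> card A + 2 \<le> card (nbrs E r) + card S"
    and card_S: "card A < 2 * card S"
  shows "all_edges A \<subseteq> E"
proof -
  have "finite S" using S_subset simple finite_subset by (auto simp: simple_graph_def)
  have complete_S: "{x, y} \<in> E" if "x \<in> S" "y \<in> S" "x \<noteq> y" for x y
    using that degree_S[of x] degree_S[of y] S_subset by (intro closed) auto
  have complete_S_A: "{x, r} \<in> E" if "x \<in> S" "r \<in> A" "x \<noteq> r" for x r
  proof (rule closed)
    have "S - {x} \<subseteq> nbrs E x" unfolding nbrs_def using complete_S[OF that(1)] by blast
    then have "card (S - {x}) \<le> card (nbrs E x)" by (rule card_mono[OF finite_nbrs[OF simple]])
    then have "card S - 1 \<le> card (nbrs E x)"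
      using that(1) \<open>finite S\<close> by (simp add: card_Diff_singleton)
    then show "card A < card (nbrs E x) + card (nbrs E r)" using degree_A[OF that(2)] by linarith
  qed (use that S_subset in auto)
  have complete_A: "{r, q} \<in> E" if pair: "r \<in> A" "q \<in> A" "r \<noteq> q" for r q
  proof (cases "r \<in> S \<or> q \<in> S")
    case True
    then show ?thesis
      using complete_S_A[of r q] complete_S_A[of q r] pair by (auto simp: insert_commute)
  next
    case False
    have "card S \<le> card (nbrs E w)" if "w \<in> A" "w \<notin> S" for w
    proof (rule card_mono[OF finite_nbrs[OF simple]])
      have "{x, w} \<in> E" if "x \<in> S" for x using complete_S_A[of x w] that \<open>w \<in> A\<close> \<open>w \<notin> S\<close> by blast
      then show "S \<subseteq> nbrs E w" by (auto simp: in_nbrs_iff insert_commute)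
    qed
    then have "card S \<le> card (nbrs E r)" "card S \<le> card (nbrs E q)" using False pair by auto
    then show ?thesis using card_S by (intro closed[OF pair]) linarith
  qed
  show ?thesis
  proof
    fix e assume "e \<in> all_edges A"
    then obtain u v where "e = {u, v}" "u \<in> A" "v \<in> A" "u \<noteq> v" by (rule all_edgesE)
    then show "e \<in> E" using complete_A by simp
  qed
qed

lemma hamilton_connected_of_core:
  assumes simple: "simple_graph V E" and A_subset: "A \<subseteq> V" and S_subset: "S \<subseteq> A"
    and degree_S: "\<And>x. x \<in> S \<Longrightarrow> card A < 2 * card (nbrs E x \<inter> A)"
    and degree_A: "\<And>r. r \<in> A \<Longrightarrow> card A + 2 \<le> card (nbrs E r \<inter> A) + card S"
    and card_S: "card A < 2 * card S"
  shows "hamilton_connected A E"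
  unfolding hamilton_connected_def
proof (intro ballI impI)
  fix a b assume ends: "a \<in> A" "b \<in> A" "a \<noteq> b"
  have "finite A" using simple A_subset finite_subset by (auto simp: simple_graph_def)
  let ?E = "E \<inter> all_edges A"
  have nbrs_A: "nbrs ?E x = nbrs E x \<inter> A" if "x \<in> A" for x
    using that nbrs_subset[OF simple, of x] by (auto simp: in_nbrs_iff doubleton_in_all_edges_iff)
  have "spanning_path A ?E a b"
  proof (rule ccontr)
    assume no_path: "\<not> ?thesis"
    have "simple_graph A ?E" using \<open>finite A\<close> by (simp add: simple_graph_def)
    then obtain F where supergraph: "?E \<subseteq> F" "simple_graph A F" "\<not> spanning_path A F a b"
      and maximal: "\<And>e. e \<in> all_edges A - F \<Longrightarrow> spanning_path A (insert e F) a b"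
      using edge_maximal_supergraph[of A ?E "\<lambda>E. spanning_path A E a b"] no_path by metis
    have degree_mono: "card (nbrs E x \<inter> A) \<le> card (nbrs F x)" if "x \<in> A" for x
      using card_mono[OF finite_nbrs[OF supergraph(2)] nbrs_mono[OF supergraph(1), of x]]
        nbrs_A[OF that] by simp
    have "all_edges A \<subseteq> F"
    proof (rule complete_of_ore_closed[OF supergraph(2) S_subset _ _ _ card_S])
      show "{u, v} \<in> F"
        if "u \<in> A" "v \<in> A" "u \<noteq> v" "card A < card (nbrs F u) + card (nbrs F v)" for u v
        using ore_degree_sum[OF supergraph(2) _ supergraph(3), of u v] maximal[of "{u, v}"] that
        by (auto simp: doubleton_in_all_edges_iff)
      show "card A < 2 * card (nbrs F x)" if "x \<in> S" for x
        using degree_S[OF that] degree_mono[of x] that S_subset by fastforce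
      show "card A + 2 \<le> card (nbrs F r) + card S" if "r \<in> A" for r
        using degree_A[OF that] degree_mono[OF that] by linarith
    qed
    then show False using spanning_path_complete[OF \<open>finite A\<close> _ ends] supergraph(3) by simp
  qed
  then show "spanning_path A E a b" by (rule spanning_path_mono) simp
qed

locale separated_pair =
  fixes V :: "'a set" and E :: "'a set set" and d :: nat and X Y :: "'a set"
  assumes simple: "simple_graph V E" and degree: "d \<le> min_degree V E"
    and subsets: "X \<subseteq> V" "Y \<subseteq> V" and separated: "separated E X Y"
    and cards: "d \<le> Suc (card X)" "d \<le> Suc (card Y)" "2 * d \<le> Suc (card X + card Y)"
    and dense: "3 * card V + 8 \<le> 7 * d"
begin

abbreviation remainder :: "'a set" where
  "remainder \<equiv> V - (X \<union> Y)"

lemma finite_parts [simp]: "finite V" "finite X" "finite Y"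
  using simple subsets finite_subset by (auto simp: simple_graph_def)

lemma card_parts: "card X + card Y + card remainder = card V"
proof -
  have "X \<inter> Y = {}" using separated by (simp add: separated_def)
  then have "card X + card Y = card (X \<union> Y)" by (simp add: card_Un_disjoint)
  moreover have "card (X \<union> Y) \<le> card V" using subsets by (intro card_mono) auto
  moreover have "card remainder = card V - card (X \<union> Y)"
    using subsets by (intro card_Diff_subset) auto
  ultimately show ?thesis by simp
qed

lemma degree_le_card_nbrs: "v \<in> V \<Longrightarrow> d \<le> card (nbrs E v)"
  using degree min_degree_le_card_nbrs[OF simple] le_trans by blast

lemma nbrs_split:
  assumes "v \<in> V"
  shows "d \<le> card (nbrs E v \<inter> X) + card (nbrs E v \<inter> Y) + card remainder"
proof -
  have "nbrs E v \<subseteq> (nbrs E v \<inter> X \<union> nbrs E v \<inter> Y) \<union> remainder"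
    using nbrs_subset[OF simple, of v] by auto
  then have "card (nbrs E v) \<le> card ((nbrs E v \<inter> X \<union> nbrs E v \<inter> Y) \<union> remainder)"
    by (rule card_mono[rotated]) simp
  also have "\<dots> \<le> card (nbrs E v \<inter> X) + card (nbrs E v \<inter> Y) + card remainder"
    by (meson add_le_mono1 card_Un_le le_trans)
  finally show ?thesis using degree_le_card_nbrs[OF assms] by simp
qed

lemma nbrs_within:
  assumes "x \<in> X"
  shows "d \<le> card (nbrs E x \<inter> X) + card remainder"
proof -
  have "nbrs E x \<inter> Y = {}" using separated assms by (auto simp: separated_def in_nbrs_iff)
  then show ?thesis using nbrs_split[of x] assms subsets by auto
qed

lemma hamilton_connected_around:
  assumes between: "X \<subseteq> A" "A \<subseteq> V - Y"
    and attached: "\<And>r. r \<in> A - X \<Longrightarrow> d \<le> 2 * card (nbrs E r \<inter> X) + card remainder"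
  shows "hamilton_connected A E"
proof (rule hamilton_connected_of_core[OF simple _ between(1)])
  have finite_A: "finite A" using between(2) finite_subset by (metis finite_Diff finite_parts(1))
  have nbrs_X_le: "card (nbrs E v \<inter> X) \<le> card (nbrs E v \<inter> A)" for v
    using finite_A between(1) by (intro card_mono) auto
  have card_A: "card A \<le> card X + card remainder"
  proof -
    have "card A \<le> card (X \<union> remainder)" using between by (intro card_mono) auto
    then show ?thesis using card_Un_le le_trans by blast
  qed
  have card_A_le_V: "card A + d \<le> Suc (card V)" using card_A card_parts cards(2) by linarith
  show "card A < 2 * card (nbrs E x \<inter> A)" if "x \<in> X" for x
    using nbrs_within[OF that] nbrs_X_le[of x] card_A_le_V card_parts cards(3) dense by linarith
  show "card A + 2 \<le> card (nbrs E r \<inter> A) + card X" if r_in: "r \<in> A" for r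
  proof -
    have "d \<le> 2 * card (nbrs E r \<inter> X) + card remainder"
      using attached[of r] nbrs_within[of r] r_in by (cases "r \<in> X") auto
    then show ?thesis using nbrs_X_le[of r] card_A card_parts cards(3) dense by linarith
  qed
  show "card A < 2 * card X" using cards(1) card_A_le_V dense by linarith
qed (use between in auto)

end

lemma hamilton_connected_bipartition:
  assumes simple: "simple_graph V E" and degree: "d \<le> min_degree V E"
    and dense: "3 * card V + 8 \<le> 7 * d" and separation: "has_separation d V E"
  obtains A where "A \<subseteq> V" "d \<le> Suc (card A)" "d \<le> Suc (card (V - A))"
    "hamilton_connected A E" "hamilton_connected (V - A) E"
proof -
  obtain X Y where pair: "X \<subseteq> V" "Y \<subseteq> V" "separated E X Y" "d \<le> card X" "d \<le> Suc (card Y)"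
    using separation by (auto simp: has_separation_def)
  interpret X: separated_pair V E d X Y
    using simple degree dense pair by unfold_locales auto
  interpret Y: separated_pair V E d Y X
    using simple degree dense pair by unfold_locales (auto simp: separated_commute)
  let ?R = "X.remainder"
  define A where "A = X \<union> {r \<in> ?R. d \<le> 2 * card (nbrs E r \<inter> X) + card ?R}"
  have "X \<inter> Y = {}" using pair(3) by (simp add: separated_def)
  then have inclusions: "X \<subseteq> A" "A \<subseteq> V - Y" "Y \<subseteq> V - A" "V - A \<subseteq> V - X"
    using pair(1,2) by (auto simp: A_def)
  have "hamilton_connected A E"
    by (rule X.hamilton_connected_around[OF inclusions(1,2)]) (auto simp: A_def)
  moreover have "hamilton_connected (V - A) E"
  proof (rule Y.hamilton_connected_around[OF inclusions(3,4)])
    fix r assume r_in: "r \<in> V - A - Y"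
    then have "2 * card (nbrs E r \<inter> X) + card ?R < d" by (auto simp: A_def)
    then show "d \<le> 2 * card (nbrs E r \<inter> Y) + card Y.remainder"
      using X.nbrs_split[of r] r_in by (simp add: Un_commute)
  qed
  moreover have "card X \<le> card A" "card Y \<le> card (V - A)"
    using inclusions X.finite_parts by (auto intro!: card_mono intro: finite_subset)
  ultimately show ?thesis using that[of A] inclusions pair(4,5) by auto
qed

definition cross_edges :: "'a set \<Rightarrow> 'a set \<Rightarrow> 'a set set" where
  "cross_edges A B = {e. \<exists>a\<in>A. \<exists>b\<in>B. e = {a, b}}"

lemma cross_edges_avoiding: "{e \<in> cross_edges A B. e \<inter> U = {}} = cross_edges (A - U) (B - U)"
  by (fastforce simp: cross_edges_def)

lemma cross_edges_subset:
  assumes "A \<inter> B = {}" "A \<subseteq> V" "B \<subseteq> V"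
  shows "cross_edges A B \<subseteq> all_edges V"
  using assms by (auto simp: cross_edges_def doubleton_in_all_edges_iff)

lemma card_cross_edges:
  assumes "A \<inter> B = {}"
  shows "card (cross_edges A B) = card A * card B"
proof -
  have "cross_edges A B = (\<lambda>(a, b). {a, b}) ` (A \<times> B)" by (auto simp: cross_edges_def)
  moreover have "inj_on (\<lambda>(a, b). {a, b}) (A \<times> B)"
    using assms by (auto simp: inj_on_def doubleton_eq_iff)
  ultimately show ?thesis by (simp add: card_image card_cartesian_product)
qed

definition has_matching :: "'a set set \<Rightarrow> nat \<Rightarrow> bool" where
  "has_matching E k \<longleftrightarrow> (\<exists>M\<subseteq>E. disjoint M \<and> card M = k)"

lemma hamiltonian_of_spanning_paths:
  assumes "spanning_path A E a a'" "spanning_path B E b b'" "A \<inter> B = {}"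
    "A \<noteq> {}" "B \<noteq> {}" "{a', b} \<in> E" "{b', a} \<in> E" "3 \<le> card (A \<union> B)"
  shows "hamiltonian (A \<union> B) E"
proof -
  obtain P where P_path: "is_path E P" "set P = A" "hd P = a" "last P = a'"
    using assms(1) unfolding spanning_path_def by blast
  obtain Q where Q_path: "is_path E Q" "set Q = B" "hd Q = b" "last Q = b'"
    using assms(2) unfolding spanning_path_def by blast
  have joined_path: "is_path E (P @ Q)" using P_path Q_path assms by (simp add: is_path_append_iff)
  moreover have "length (P @ Q) = card (A \<union> B)"
    using joined_path P_path(2) Q_path(2) distinct_card[of "P @ Q"] by (simp add: is_path_def)
  moreover have "P \<noteq> []" "Q \<noteq> []" using P_path Q_path assms by auto
  ultimately have "is_cycle E (P @ Q)"
    using P_path Q_path assms by (simp add: is_cycle_iff_path)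
  then show ?thesis unfolding hamiltonian_def using P_path(2) Q_path(2) by (metis set_append)
qed

lemma hamiltonian_of_cross_matching:
  assumes A_subset: "A \<subseteq> V" and card: "3 \<le> card V"
    and connected: "hamilton_connected A E" "hamilton_connected (V - A) E"
    and matching: "has_matching (cross_edges A (V - A) \<inter> E) 2"
  shows "hamiltonian V E"
proof -
  obtain e f where matching_edges: "{e, f} \<subseteq> cross_edges A (V - A) \<inter> E" "disjoint {e, f}" "e \<noteq> f"
    using matching by (auto simp: has_matching_def card_2_iff)
  obtain a b where e_eq: "e = {a, b}" "a \<in> A" "b \<in> V - A"
    using matching_edges(1) by (auto simp: cross_edges_def)
  obtain a' b' where f_eq: "f = {a', b'}" "a' \<in> A" "b' \<in> V - A"
    using matching_edges(1) by (auto simp: cross_edges_def)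
  have "e \<inter> f = {}" using matching_edges(2,3) by (intro disjointD) auto
  then have "a \<noteq> a'" "b \<noteq> b'" using e_eq(1) f_eq(1) by auto
  then have "spanning_path A E a a'" "spanning_path (V - A) E b' b"
    using connected e_eq f_eq by (auto simp: hamilton_connected_def)
  then have "hamiltonian (A \<union> (V - A)) E"
    by (rule hamiltonian_of_spanning_paths)
      (use A_subset card e_eq f_eq matching_edges(1) in \<open>auto simp: insert_commute Un_absorb1\<close>)
  then show ?thesis using A_subset by (simp add: Un_absorb1)
qed

section \<open>Matchings and independent sets\<close>

lemma maximal_disjoint_subfamily:
  assumes "finite \<A>" "{} \<notin> \<A>"
  obtains M where "M \<subseteq> \<A>" "disjoint M" "\<And>A. A \<in> \<A> \<Longrightarrow> A \<inter> \<Union>M \<noteq> {}"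
proof -
  let ?\<M> = "{M. M \<subseteq> \<A> \<and> disjoint M}"
  have "finite ?\<M>" by (rule finite_subset[of _ "Pow \<A>"]) (use assms(1) in auto)
  moreover have "{} \<in> ?\<M>" by simp
  ultimately obtain M where disjoint_M: "M \<in> ?\<M>" and maximal: "\<And>N. N \<in> ?\<M> \<Longrightarrow> M \<subseteq> N \<Longrightarrow> M = N"
    by (metis (no_types, lifting) finite_has_maximal2)
  have "A \<inter> \<Union>M \<noteq> {}" if A_in: "A \<in> \<A>" for A
  proof
    assume avoids: "A \<inter> \<Union>M = {}"
    then have "insert A M \<in> ?\<M>"
      using disjoint_M A_in by (auto simp: pairwise_insert disjnt_def)
    then have "A \<in> M" using maximal[of "insert A M"] by auto
    then have "A = {}" using avoids by auto
    then show False using A_in assms(2) by simp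
  qed
  then show ?thesis using that disjoint_M by blast
qed

lemma has_matching_mono: "has_matching E k \<Longrightarrow> E \<subseteq> F \<Longrightarrow> has_matching F k"
  unfolding has_matching_def by blast

lemma maximal_small_matching:
  assumes "finite E" "{} \<notin> E" "\<not> has_matching E k"
  obtains M where "M \<subseteq> E" "disjoint M" "card M < k" "\<And>e. e \<in> E \<Longrightarrow> e \<inter> \<Union>M \<noteq> {}"
proof -
  obtain M where maximal: "M \<subseteq> E" "disjoint M" "\<And>e. e \<in> E \<Longrightarrow> e \<inter> \<Union>M \<noteq> {}"
    using maximal_disjoint_subfamily[OF assms(1,2)] by metis
  have "card M < k"
  proof (rule ccontr)
    assume "\<not> card M < k"
    then obtain T where "T \<subseteq> M" "card T = k"
      using obtain_subset_with_card_n[of k M] by (metis not_less)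
    moreover from this have "disjoint T" "T \<subseteq> E" using maximal(1,2) by (auto intro: pairwise_subset)
    ultimately show False using assms(3) by (auto simp: has_matching_def)
  qed
  then show ?thesis using that maximal by blast
qed

lemma few_sets_meeting_all:
  assumes "finite V" "\<And>A. A \<in> \<A> \<Longrightarrow> A \<subseteq> V \<and> m \<le> card A" "card V < Suc k * m"
  shows "\<exists>\<B>\<subseteq>\<A>. finite \<B> \<and> card \<B> \<le> k \<and> (\<forall>A\<in>\<A>. \<exists>B\<in>\<B>. A \<inter> B \<noteq> {})"
proof -
  have "finite \<A>" by (rule finite_subset[of _ "Pow V"]) (use assms(1,2) in auto)
  moreover have "{} \<notin> \<A>" using assms(2)[of "{}"] assms(3) by auto
  ultimately obtain \<B> where subfamily: "\<B> \<subseteq> \<A>" "disjoint \<B>" "\<And>A. A \<in> \<A> \<Longrightarrow> A \<inter> \<Union>\<B> \<noteq> {}"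
    using maximal_disjoint_subfamily by metis
  have finite_subfamily: "finite \<B>" using subfamily(1) \<open>finite \<A>\<close> by (rule finite_subset)
  have members: "B \<subseteq> V" "finite B" "m \<le> card B" if "B \<in> \<B>" for B
    using that subfamily(1) assms(1,2) by (auto intro: finite_subset)
  have "card \<B> * m = (\<Sum>B\<in>\<B>. m)" by simp
  also have "\<dots> \<le> sum card \<B>" by (rule sum_mono) (rule members)
  also have "\<dots> = card (\<Union>\<B>)" using card_Union_disjoint[OF subfamily(2)] members(2) by simp
  also have "\<dots> \<le> card V" using members(1) assms(1) by (intro card_mono) auto
  finally have "card \<B> * m < Suc k * m" using assms(3) by simp
  then have "card \<B> \<le> k" unfolding mult_less_cancel2 by simp
  moreover have "\<forall>A\<in>\<A>. \<exists>B\<in>\<B>. A \<inter> B \<noteq> {}" using subfamily(3) by blast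
  ultimately show ?thesis using subfamily(1) finite_subfamily by blast
qed

lemma card_Un_independent_sets:
  assumes simple: "simple_graph V E"
    and I_independent: "I \<subseteq> V" "independent_set E I"
    and J_independent: "J \<subseteq> V" "independent_set E J" and meet: "I \<inter> J \<noteq> {}"
  shows "min_degree V E + card (I \<union> J) \<le> card V"
proof -
  obtain v where common: "v \<in> I" "v \<in> J" using meet by blast
  have finite_V: "finite V" using simple by (simp add: simple_graph_def)
  have "nbrs E v \<inter> (I \<union> J) = {}"
    using I_independent(2) J_independent(2) common by (auto simp: independent_set_def in_nbrs_iff)
  moreover have "finite (I \<union> J)"
    using I_independent J_independent finite_V by (auto intro: finite_subset)
  ultimately have "card (nbrs E v) + card (I \<union> J) = card (nbrs E v \<union> (I \<union> J))"
    using finite_nbrs[OF simple] by (simp add: card_Un_disjoint)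
  also have "\<dots> \<le> card V"
    using nbrs_subset[OF simple, of v] I_independent J_independent finite_V
    by (intro card_mono) auto
  finally show ?thesis
    using min_degree_le_card_nbrs[OF simple, of v] common I_independent(1) by auto
qed

lemma card_matching_in_independent_set:
  assumes "finite J" "M \<subseteq> all_edges J" "disjoint M" "independent_set M I"
  shows "card M \<le> card (J - I)"
proof -
  have "\<exists>x. x \<in> e \<inter> (J - I)" if e_in: "e \<in> M" for e
  proof -
    have "e \<in> all_edges J" using e_in assms(2) by blast
    then obtain a b where "e = {a, b}" "a \<in> J" "b \<in> J" by (rule all_edgesE)
    then show ?thesis using assms(4) e_in unfolding independent_set_def by auto
  qed
  then obtain f where private_vertex: "\<And>e. e \<in> M \<Longrightarrow> f e \<in> e \<inter> (J - I)" by metis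
  have "inj_on f M"
  proof (rule inj_onI)
    fix e e' assume "e \<in> M" "e' \<in> M" "f e = f e'"
    then show "e = e'"
      using private_vertex[of e] private_vertex[of e'] disjointD[OF assms(3), of e e'] by auto
  qed
  moreover have "f ` M \<subseteq> J - I" using private_vertex by auto
  ultimately show ?thesis using assms(1) by (intro card_inj_on_le) auto
qed

lemma matching_destroys_independent_set:
  assumes simple: "simple_graph V E" and degree: "d \<le> min_degree V E"
    and I_independent: "I \<subseteq> V" "independent_set E I" "d < card I"
    and J_independent: "J \<subseteq> V" "independent_set E J"
    and meet: "I \<inter> J \<noteq> {}" and matching: "has_matching (all_edges J \<inter> R) (card V - 2 * d)"
  shows "\<not> independent_set (R \<inter> all_edges V) I"
proof
  assume "independent_set (R \<inter> all_edges V) I"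
  obtain M where M_matching: "M \<subseteq> all_edges J" "M \<subseteq> R" "disjoint M" "card M = card V - 2 * d"
    using matching by (auto simp: has_matching_def)
  have finite_sets: "finite I" "finite J"
    using simple I_independent(1) J_independent(1) finite_subset by (auto simp: simple_graph_def)
  have "card (I \<union> J) = card I + card (J - I)"
    using finite_sets card_Un_disjoint[of I "J - I"] by simp
  then have "d + card I + card (J - I) \<le> card V"
    using card_Un_independent_sets[OF simple I_independent(1,2) J_independent meet] degree
    by linarith
  moreover have "independent_set M I"
    using \<open>independent_set (R \<inter> all_edges V) I\<close> M_matching(1,2) all_edges_mono[OF J_independent(1)]
    by (intro independent_set_antimono[of "R \<inter> all_edges V" I M]) auto
  then have "card V - 2 * d \<le> card (J - I)"
    using card_matching_in_independent_set[OF finite_sets(2) M_matching(1,3)] M_matching(4) by simp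
  ultimately show False using I_independent(3) by linarith
qed

lemma hamiltonian_of_matchings:
  assumes simple: "simple_graph V H" and degree: "d \<le> min_degree V H"
    and card: "3 \<le> card V" "3 * card V < 7 * d" and no_separation: "\<not> has_separation d V H"
    and members: "\<And>J. J \<in> \<J> \<Longrightarrow> J \<subseteq> V \<and> independent_set H J"
    and meets: "\<And>I. \<lbrakk>I \<subseteq> V; independent_set H I; d < card I\<rbrakk> \<Longrightarrow> \<exists>J\<in>\<J>. I \<inter> J \<noteq> {}"
    and matching: "\<And>J. J \<in> \<J> \<Longrightarrow> has_matching (all_edges J \<inter> R) (card V - 2 * d)"
  shows "hamiltonian V (H \<union> R)"
proof -
  let ?G = "H \<union> (R \<inter> all_edges V)"
  have simple_G: "simple_graph V ?G" using simple by (auto simp: simple_graph_def)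
  have degree_G: "d \<le> min_degree V ?G"
    using degree min_degree_mono[OF simple_G, of H] card(1) by fastforce
  have "hamiltonian V ?G"
  proof (rule hamiltonian_of_small_independent_sets[OF simple_G card(1)])
    show "3 * card V < 7 * min_degree V ?G" using card(2) degree_G by linarith
    show "\<not> has_separation (min_degree V ?G) V ?G"
      using has_separation_antimono[OF _ degree_G, of V ?G H] no_separation by blast
    show "card I \<le> min_degree V ?G" if I_independent: "I \<subseteq> V" "independent_set ?G I" for I
    proof (rule ccontr)
      assume "\<not> card I \<le> min_degree V ?G"
      then have large: "d < card I" using degree_G by linarith
      have independent_H: "independent_set H I"
        and independent_R: "independent_set (R \<inter> all_edges V) I"
        using I_independent(2) by (auto intro: independent_set_antimono)
      obtain J where "J \<in> \<J>" "I \<inter> J \<noteq> {}"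
        using meets[OF I_independent(1) independent_H large] by blast
      then have "\<not> independent_set (R \<inter> all_edges V) I"
        using members matching I_independent(1) independent_H large
        by (intro matching_destroys_independent_set[OF simple degree, of I J]) auto
      then show False using independent_R by blast
    qed
  qed
  then show ?thesis by (rule hamiltonian_mono) blast
qed

section \<open>Matchings in the binomial random graph\<close>

lemma real_card_all_edges:
  assumes "finite V"
  shows "real (card (all_edges V)) = real (card V) * (real (card V) - 1) / 2"
proof -
  have "card (all_edges V) = card V choose 2"
    unfolding all_edges_def by (rule n_subsets[OF assms])
  moreover have "real (n choose 2) = real n * (real n - 1) / 2" for n
    by (induction n) (simp_all add: numeral_2_eq_2 field_simps)
  ultimately show ?thesis by simp
qed

lemma card_all_edges_le:
  assumes "finite V" "S \<subseteq> all_edges V"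
  shows "real (card S) \<le> (real (card V))\<^sup>2"
proof -
  have "real (card S) \<le> real (card (all_edges V))"
    using card_mono[OF finite_all_edges[OF assms(1)] assms(2)] by simp
  also have "\<dots> \<le> (real (card V))\<^sup>2"
    by (simp add: real_card_all_edges[OF assms(1)] power2_eq_square algebra_simps)
  finally show ?thesis .
qed

lemma all_edges_avoiding: "{e \<in> all_edges W. e \<inter> U = {}} = all_edges (W - U)"
  by (auto simp: all_edges_def)

lemma card_le_card_Diff_Union:
  assumes "finite A" "finite M" "\<And>e. e \<in> M \<Longrightarrow> card (A \<inter> e) \<le> m"
  shows "card A \<le> card (A - \<Union>M) + m * card M"
proof -
  have "card (A \<inter> \<Union>M) = card (\<Union>e\<in>M. A \<inter> e)" by (simp only: Int_Union)
  also have "\<dots> \<le> (\<Sum>e\<in>M. card (A \<inter> e))" by (rule card_UN_le[OF assms(2)])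
  also have "\<dots> \<le> m * card M"
    using sum_bounded_above[of M "\<lambda>e. card (A \<inter> e)" m] assms(3) by (simp add: mult.commute)
  finally show ?thesis using card_Int_Diff[OF assms(1), of "\<Union>M"] by simp
qed

text \<open>The factor \<open>L ^ k\<close> pays for damping the weight of each element from \<open>p\<close> to \<open>p / L\<close>.\<close>

lemma sum_power_card_small_subsets:
  fixes p L :: real
  assumes "finite S" "0 \<le> p" "1 \<le> L"
  shows "(\<Sum>M | M \<subseteq> S \<and> card M < k. p ^ card M) \<le> L ^ k * exp (p * card S / L)"
proof -
  have "(\<Sum>M | M \<subseteq> S \<and> card M < k. p ^ card M) \<le> (\<Sum>M | M \<subseteq> S \<and> card M < k. L ^ k * (p / L) ^ card M)"
  proof (rule sum_mono)
    fix M assume "M \<in> {M. M \<subseteq> S \<and> card M < k}"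
    then have "L ^ card M * (p / L) ^ card M \<le> L ^ k * (p / L) ^ card M"
      using assms by (intro mult_right_mono power_increasing) auto
    then show "p ^ card M \<le> L ^ k * (p / L) ^ card M" using assms(3) by (simp add: power_divide)
  qed
  also have "\<dots> \<le> (\<Sum>M\<in>Pow S. L ^ k * (p / L) ^ card M)"
    using assms by (intro sum_mono2) auto
  also have "\<dots> = L ^ k * (1 + p / L) ^ card S"
    using prod_add[OF assms(1), of "\<lambda>_. p / L" "\<lambda>_. 1"]
    by (simp add: sum_distrib_left[symmetric] add.commute)
  also have "\<dots> \<le> L ^ k * exp (p / L) ^ card S"
    using assms by (intro mult_left_mono power_mono exp_ge_add_one_self) auto
  also have "exp (p / L) ^ card S = exp (p * card S / L)"
    by (simp add: exp_of_nat_mult[symmetric] mult.commute)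
  finally show ?thesis .
qed

locale random_graph =
  fixes V :: "'a set" and p :: real
  assumes finite_V: "finite V" and p_ge_0: "0 \<le> p" and p_le_1: "p \<le> 1"
begin

abbreviation prob :: "'a set set set \<Rightarrow> real" where
  "prob \<equiv> measure_pmf.prob (binomial_random_graph V p)"

lemma prob_mono: "\<A> \<subseteq> \<B> \<Longrightarrow> prob \<A> \<le> prob \<B>"
  by (rule measure_pmf.finite_measure_mono) simp_all

lemma prob_Union_le: "finite I \<Longrightarrow> prob (\<Union>i\<in>I. \<A> i) \<le> (\<Sum>i\<in>I. prob (\<A> i))"
  by (rule measure_pmf.finite_measure_subadditive_finite) simp_all

lemma prob_Compl: "prob (- \<A>) = 1 - prob \<A>"
  using measure_pmf.prob_compl[of \<A> "binomial_random_graph V p"]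
  by (simp add: Compl_eq_Diff_UNIV)

lemma prob_contains_avoids:
  assumes edge_sets: "A \<subseteq> all_edges V" "B \<subseteq> all_edges V" "A \<inter> B = {}"
  shows "prob {R. A \<subseteq> R \<and> B \<inter> R = {}} = p ^ card A * (1 - p) ^ card B"
proof -
  let ?S = "all_edges V"
  define C where "C = (\<lambda>e. if e \<in> A then {True} else if e \<in> B then {False} else UNIV)"
  have notin_A: "e \<notin> A" if "e \<in> B" for e using edge_sets(3) that by auto
  have finite_edges: "finite ?S" by (rule finite_all_edges[OF finite_V])
  have preimage: "(\<lambda>f. {e \<in> ?S. f e}) -` {R. A \<subseteq> R \<and> B \<inter> R = {}} = Pi ?S C"
  proof (rule set_eqI)
    fix f
    have "f \<in> Pi ?S C \<longleftrightarrow> (\<forall>e\<in>?S. (e \<in> A \<longrightarrow> f e) \<and> (e \<in> B \<longrightarrow> \<not> f e))"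
      using notin_A by (auto simp: C_def Pi_iff)
    also have "\<dots> \<longleftrightarrow> f \<in> (\<lambda>f. {e \<in> ?S. f e}) -` {R. A \<subseteq> R \<and> B \<inter> R = {}}"
      using edge_sets(1,2) by auto
    finally show "f \<in> (\<lambda>f. {e \<in> ?S. f e}) -` {R. A \<subseteq> R \<and> B \<inter> R = {}} \<longleftrightarrow> f \<in> Pi ?S C" ..
  qed
  have "prob {R. A \<subseteq> R \<and> B \<inter> R = {}}
    = measure_pmf.prob (Pi_pmf ?S False (\<lambda>_. bernoulli_pmf p)) (Pi ?S C)"
    unfolding binomial_random_graph_def measure_map_pmf preimage ..
  also have "\<dots> = (\<Prod>e\<in>?S. measure_pmf.prob (bernoulli_pmf p) (C e))"
    by (rule measure_Pi_pmf_Pi[OF finite_edges])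
  also have "\<dots> = (\<Prod>e\<in>?S. (if e \<in> A then p else 1) * (if e \<in> B then 1 - p else 1))"
    using notin_A p_ge_0 p_le_1 by (intro prod.cong refl) (auto simp: C_def measure_pmf_single)
  also have "\<dots> = (\<Prod>e\<in>A. p) * (\<Prod>e\<in>B. 1 - p)"
    using edge_sets finite_edges by (simp add: prod.distrib prod.If_cases Int_absorb1)
  finally show ?thesis by simp
qed

lemma prob_contains_avoids_le:
  fixes N :: real
  assumes "A \<subseteq> all_edges V" "B \<subseteq> all_edges V" "A \<inter> B = {}" "N \<le> card B"
  shows "prob {R. A \<subseteq> R \<and> B \<inter> R = {}} \<le> p ^ card A * exp (- p * N)"
proof -
  have "(1 - p) ^ card B \<le> exp (- p) ^ card B"
    using p_le_1 exp_ge_add_one_self[of "- p"] by (intro power_mono) auto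
  also have "\<dots> = exp (- p * card B)" by (simp add: exp_of_nat_mult[symmetric] mult.commute)
  also have "\<dots> \<le> exp (- p * N)" using assms(4) p_ge_0 by (simp add: mult_left_mono)
  finally show ?thesis
    using p_ge_0 by (simp add: prob_contains_avoids[OF assms(1-3)] mult_left_mono)
qed

text \<open>If there is no matching of size \<open>k\<close>, then some matching \<open>M\<close> with fewer than \<open>k\<close> edges is
  present while all edges disjoint from it are absent.\<close>

lemma prob_no_matching_le:
  fixes L N :: real
  assumes S_edges: "S \<subseteq> all_edges V" and "1 \<le> L"
    and many_avoiding: "\<And>M. \<lbrakk>M \<subseteq> S; disjoint M; card M < k\<rbrakk> \<Longrightarrow> N \<le> card {e \<in> S. e \<inter> \<Union>M = {}}"
  shows "prob {R. \<not> has_matching (S \<inter> R) k} \<le> L ^ k * exp (p * card S / L - p * N)"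
proof -
  let ?avoiding = "\<lambda>M. {e \<in> S. e \<inter> \<Union>M = {}}"
  let ?\<M> = "{M. M \<subseteq> S \<and> disjoint M \<and> card M < k}" and ?\<N> = "{M. M \<subseteq> S \<and> card M < k}"
  have finite_S: "finite S" using S_edges finite_all_edges[OF finite_V] by (rule finite_subset)
  then have finite_families: "finite ?\<N>" "finite ?\<M>" by auto
  have "{} \<notin> S" using S_edges by (auto simp: all_edges_def)
  have "{R. \<not> has_matching (S \<inter> R) k} \<subseteq> (\<Union>M\<in>?\<M>. {R. M \<subseteq> R \<and> ?avoiding M \<inter> R = {}})"
  proof
    fix R assume "R \<in> {R. \<not> has_matching (S \<inter> R) k}"
    then obtain M where "M \<subseteq> S \<inter> R" "disjoint M" "card M < k"
      "\<And>e. e \<in> S \<inter> R \<Longrightarrow> e \<inter> \<Union>M \<noteq> {}"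
      using maximal_small_matching[of "S \<inter> R" k] finite_S \<open>{} \<notin> S\<close> by auto
    then show "R \<in> (\<Union>M\<in>?\<M>. {R. M \<subseteq> R \<and> ?avoiding M \<inter> R = {}})" by blast
  qed
  then have "prob {R. \<not> has_matching (S \<inter> R) k}
      \<le> prob (\<Union>M\<in>?\<M>. {R. M \<subseteq> R \<and> ?avoiding M \<inter> R = {}})"
    by (rule prob_mono)
  also have "\<dots> \<le> (\<Sum>M\<in>?\<M>. prob {R. M \<subseteq> R \<and> ?avoiding M \<inter> R = {}})"
    by (rule prob_Union_le[OF finite_families(2)])
  also have "\<dots> \<le> (\<Sum>M\<in>?\<M>. p ^ card M * exp (- p * N))"
  proof (rule sum_mono)
    fix M assume M_in: "M \<in> ?\<M>"
    have "e = {}" if "e \<in> M" "e \<inter> \<Union>M = {}" for e using that by blast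
    then have "M \<inter> ?avoiding M = {}" using \<open>{} \<notin> S\<close> by auto
    then show "prob {R. M \<subseteq> R \<and> ?avoiding M \<inter> R = {}} \<le> p ^ card M * exp (- p * N)"
      using M_in S_edges many_avoiding by (intro prob_contains_avoids_le) auto
  qed
  also have "\<dots> = (\<Sum>M\<in>?\<M>. p ^ card M) * exp (- p * N)" by (simp add: sum_distrib_right)
  also have "\<dots> \<le> (\<Sum>M\<in>?\<N>. p ^ card M) * exp (- p * N)"
    using finite_families p_ge_0 by (intro mult_right_mono sum_mono2) auto
  also have "\<dots> \<le> (L ^ k * exp (p * card S / L)) * exp (- p * N)"
    using sum_power_card_small_subsets[OF finite_S p_ge_0 \<open>1 \<le> L\<close>] by (intro mult_right_mono) auto
  also have "\<dots> = L ^ k * exp (p * card S / L - p * N)"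
    by (simp add: exp_diff exp_minus divide_inverse)
  finally show ?thesis .
qed

lemma prob_no_matching_dense:
  fixes c :: real
  assumes S_edges: "S \<subseteq> all_edges V" and c_bounds: "0 < c" "c \<le> 2"
    and dense: "\<And>M. \<lbrakk>M \<subseteq> S; disjoint M; card M < k\<rbrakk>
      \<Longrightarrow> c * (real (card V))\<^sup>2 \<le> card {e \<in> S. e \<inter> \<Union>M = {}}"
  shows "prob {R. \<not> has_matching (S \<inter> R) k} \<le> (2 / c) ^ k * exp (- p * c * (real (card V))\<^sup>2 / 2)"
proof -
  let ?n = "real (card V)"
  have "prob {R. \<not> has_matching (S \<inter> R) k}
      \<le> (2 / c) ^ k * exp (p * card S / (2 / c) - p * (c * ?n\<^sup>2))"
    by (rule prob_no_matching_le[OF S_edges]) (use c_bounds in simp, rule dense)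
  also have "\<dots> \<le> (2 / c) ^ k * exp (- p * c * ?n\<^sup>2 / 2)"
  proof -
    have "(p * c) * card S \<le> (p * c) * ?n\<^sup>2"
      using card_all_edges_le[OF finite_V S_edges] p_ge_0 c_bounds by (intro mult_left_mono) auto
    then show ?thesis using c_bounds by (intro mult_left_mono) (auto simp: algebra_simps)
  qed
  finally show ?thesis .
qed

lemma prob_no_matching_clique:
  assumes W_subset: "W \<subseteq> V" and large: "real (card V) / 4 + 2 * real k \<le> real (card W)"
  shows "prob {R. \<not> has_matching (all_edges W \<inter> R) k}
    \<le> 64 ^ k * exp (- p * (real (card V))\<^sup>2 / 64)"
proof -
  let ?n = "real (card V)"
  have dense: "1 / 32 * ?n\<^sup>2 \<le> card {e \<in> all_edges W. e \<inter> \<Union>M = {}}"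
    if matching: "M \<subseteq> all_edges W" "disjoint M" "card M < k" for M
  proof -
    let ?U = "W - \<Union>M"
    have finite_sets: "finite W" "finite M"
      using finite_subset[OF W_subset finite_V] finite_subset[OF matching(1)] finite_all_edges
      by auto
    have "card (W \<inter> e) \<le> 2" if "e \<in> M" for e
      using that matching(1) by (auto simp: all_edges_def Int_absorb1)
    then have "card W \<le> card ?U + 2 * card M" by (rule card_le_card_Diff_Union[OF finite_sets])
    then have "?n / 4 \<le> real (card ?U) - 1" using large matching(3) by linarith
    then have "?n / 4 * (?n / 4) \<le> real (card ?U) * (real (card ?U) - 1)"
      by (intro mult_mono) auto
    then show ?thesis
      using finite_sets by (simp add: all_edges_avoiding real_card_all_edges power2_eq_square)
  qed
  show ?thesis
    using prob_no_matching_dense[OF all_edges_mono[OF W_subset] _ _ dense] by simp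
qed

lemma prob_no_cross_matching:
  assumes parts: "A \<subseteq> V" "B \<subseteq> V" "A \<inter> B = {}"
    and large: "real (card V) / 4 + real k \<le> real (card A)"
      "real (card V) / 4 + real k \<le> real (card B)"
  shows "prob {R. \<not> has_matching (cross_edges A B \<inter> R) k}
    \<le> 64 ^ k * exp (- p * (real (card V))\<^sup>2 / 64)"
proof -
  let ?n = "real (card V)"
  have dense: "1 / 32 * ?n\<^sup>2 \<le> card {e \<in> cross_edges A B. e \<inter> \<Union>M = {}}"
    if matching: "M \<subseteq> cross_edges A B" "disjoint M" "card M < k" for M
  proof -
    let ?U = "\<Union>M"
    have "finite (cross_edges A B)"
      using cross_edges_subset[OF parts(3,1,2)] finite_all_edges[OF finite_V]
      by (rule finite_subset)
    then have finite_sets: "finite A" "finite B" "finite M"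
      using parts finite_V matching(1) by (auto intro: finite_subset)
    have single: "card (A \<inter> e) \<le> 1" "card (B \<inter> e) \<le> 1" if e_in: "e \<in> M" for e
    proof -
      obtain a b where "e = {a, b}" "a \<in> A" "b \<in> B"
        using e_in matching(1) by (auto simp: cross_edges_def)
      then have "A \<inter> e = {a}" "B \<inter> e = {b}" using parts(3) by auto
      then show "card (A \<inter> e) \<le> 1" "card (B \<inter> e) \<le> 1" by simp_all
    qed
    have "card A \<le> card (A - ?U) + 1 * card M" "card B \<le> card (B - ?U) + 1 * card M"
      by (rule card_le_card_Diff_Union; use finite_sets single in simp)+
    then have "?n / 4 \<le> card (A - ?U)" "?n / 4 \<le> card (B - ?U)"
      using large matching(3) by linarith+
    then have "?n / 4 * (?n / 4) \<le> real (card (A - ?U)) * real (card (B - ?U))"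
      by (intro mult_mono) auto
    moreover have "(A - ?U) \<inter> (B - ?U) = {}" using parts(3) by auto
    ultimately have "?n\<^sup>2 / 16 \<le> card {e \<in> cross_edges A B. e \<inter> ?U = {}}"
      by (simp add: cross_edges_avoiding card_cross_edges power2_eq_square)
    then show ?thesis by (rule order_trans[rotated]) simp
  qed
  show ?thesis
    using prob_no_matching_dense[OF cross_edges_subset[OF parts(3,1,2)] _ _ dense] by simp
qed

lemma prob_many_edges_le:
  assumes S_edges: "S \<subseteq> all_edges V" and "0 < k"
  shows "prob {R. k \<le> real (card (R \<inter> S))} \<le> card S * p / k"
proof -
  let ?M = "binomial_random_graph V p"
  let ?X = "\<lambda>R. \<Sum>e\<in>S. indicator {R. e \<in> R} R :: real"
  have finite_S: "finite S" using S_edges finite_all_edges[OF finite_V] by (rule finite_subset)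
  have count: "?X R = real (card (R \<inter> S))" for R
    using finite_S by (simp add: indicator_def sum.If_cases Int_commute)
  have single: "prob {R. e \<in> R} = p" if "e \<in> S" for e
    using prob_contains_avoids[of "{e}" "{}"] that S_edges by auto
  have integrable: "integrable ?M (indicator {R. e \<in> R} :: _ \<Rightarrow> real)" for e
    by (intro measure_pmf.integrable_const_bound[of _ 1]) (auto simp: indicator_def)
  have "prob {R \<in> space ?M. k \<le> ?X R} \<le> measure_pmf.expectation ?M ?X / k"
    by (rule integral_Markov_inequality_measure[of _ _ UNIV])
      (use \<open>0 < k\<close> integrable in \<open>auto intro: sum_nonneg Bochner_Integration.integrable_sum\<close>)
  also have "measure_pmf.expectation ?M ?X = (\<Sum>e\<in>S. prob {R. e \<in> R})"
    by (subst Bochner_Integration.integral_sum) (simp_all add: integrable)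
  also have "\<dots> = card S * p" using single by simp
  finally show ?thesis by (simp add: count)
qed

end

section \<open>The threshold\<close>

context random_graph
begin

lemma prob_nonhamiltonian_separated:
  assumes simple: "simple_graph V H" and degree: "d \<le> min_degree V H"
    and d_bounds: "31 * card V \<le> 64 * d" "2 * d < card V" and separation: "has_separation d V H"
  shows "prob {R. \<not> hamiltonian V (H \<union> R)} \<le> 64 ^ 2 * exp (- p * (real (card V))\<^sup>2 / 64)"
proof -
  have "3 * card V + 8 \<le> 7 * d" using d_bounds by linarith
  then obtain A where A_parts: "A \<subseteq> V" "d \<le> Suc (card A)" "d \<le> Suc (card (V - A))"
    and connected: "hamilton_connected A H" "hamilton_connected (V - A) H"
    using hamilton_connected_bipartition[OF simple degree _ separation] by metis
  have "hamiltonian V (H \<union> R)" if "has_matching (cross_edges A (V - A) \<inter> R) 2" for R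
  proof (rule hamiltonian_of_cross_matching[OF A_parts(1)])
    show "hamilton_connected A (H \<union> R)" "hamilton_connected (V - A) (H \<union> R)"
      using connected by (auto intro: hamilton_connected_mono)
    show "has_matching (cross_edges A (V - A) \<inter> (H \<union> R)) 2"
      using that by (rule has_matching_mono) auto
  qed (use d_bounds in linarith)
  then have "prob {R. \<not> hamiltonian V (H \<union> R)}
      \<le> prob {R. \<not> has_matching (cross_edges A (V - A) \<inter> R) 2}"
    by (intro prob_mono) blast
  also have "\<dots> \<le> 64 ^ 2 * exp (- p * (real (card V))\<^sup>2 / 64)"
    using A_parts d_bounds by (intro prob_no_cross_matching) auto
  finally show ?thesis .
qed

lemma prob_nonhamiltonian_unseparated:
  assumes simple: "simple_graph V H" and degree: "d \<le> min_degree V H"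
    and d_bounds: "31 * card V \<le> 64 * d" "2 * d < card V"
    and no_separation: "\<not> has_separation d V H"
  shows "prob {R. \<not> hamiltonian V (H \<union> R)}
    \<le> 2 * (64 ^ (card V - 2 * d) * exp (- p * (real (card V))\<^sup>2 / 64))"
proof -
  let ?k = "card V - 2 * d" and ?\<I> = "{I. I \<subseteq> V \<and> independent_set H I \<and> d < card I}"
  have "A \<subseteq> V \<and> Suc d \<le> card A" if "A \<in> ?\<I>" for A using that by auto
  moreover have "card V < Suc 2 * Suc d" using d_bounds by simp
  ultimately obtain \<J> where representatives: "\<J> \<subseteq> ?\<I>" "finite \<J>" "card \<J> \<le> 2"
    and meets: "\<forall>I\<in>?\<I>. \<exists>J\<in>\<J>. I \<inter> J \<noteq> {}"
    using few_sets_meeting_all[OF finite_V, of ?\<I> "Suc d" 2] by blast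
  have "hamiltonian V (H \<union> R)" if "\<And>J. J \<in> \<J> \<Longrightarrow> has_matching (all_edges J \<inter> R) ?k" for R
    by (rule hamiltonian_of_matchings[OF simple degree _ _ no_separation, of \<J>])
      (use d_bounds representatives(1) meets that in auto)
  then have "prob {R. \<not> hamiltonian V (H \<union> R)}
      \<le> prob (\<Union>J\<in>\<J>. {R. \<not> has_matching (all_edges J \<inter> R) ?k})"
    by (intro prob_mono) blast
  also have "\<dots> \<le> (\<Sum>J\<in>\<J>. prob {R. \<not> has_matching (all_edges J \<inter> R) ?k})"
    by (rule prob_Union_le[OF representatives(2)])
  also have "\<dots> \<le> (\<Sum>J\<in>\<J>. 64 ^ ?k * exp (- p * (real (card V))\<^sup>2 / 64))"
  proof (intro sum_mono prob_no_matching_clique)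
    fix J assume "J \<in> \<J>"
    then have J_large: "J \<subseteq> V" "d < card J" using representatives(1) by auto
    show "J \<subseteq> V" by (rule J_large)
    show "real (card V) / 4 + 2 * real ?k \<le> real (card J)"
      using J_large(2) d_bounds by (simp add: of_nat_diff)
  qed
  also have "\<dots> = card \<J> * (64 ^ ?k * exp (- p * (real (card V))\<^sup>2 / 64))" by simp
  also have "\<dots> \<le> 2 * (64 ^ ?k * exp (- p * (real (card V))\<^sup>2 / 64))"
    using representatives(3) by (intro mult_right_mono) auto
  finally show ?thesis .
qed

lemma prob_nonhamiltonian_le:
  assumes "simple_graph V H" "d \<le> min_degree V H"
    and d_bounds: "31 * card V \<le> 64 * d" "2 * d < card V"
  shows "prob {R. \<not> hamiltonian V (H \<union> R)}
    \<le> 2 * (64\<^sup>2) ^ (card V - 2 * d) * exp (- p * (real (card V))\<^sup>2 / 64)"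
proof -
  let ?k = "card V - 2 * d" and ?e = "exp (- p * (real (card V))\<^sup>2 / 64)"
  have "prob {R. \<not> hamiltonian V (H \<union> R)} \<le> 2 * ((64\<^sup>2) ^ ?k * ?e)"
  proof (cases "has_separation d V H")
    case True
    have "(64\<^sup>2 :: real) ^ 1 \<le> (64\<^sup>2) ^ ?k" using d_bounds(2) by (intro power_increasing) auto
    then have "64\<^sup>2 * ?e \<le> 2 * ((64\<^sup>2) ^ ?k * ?e)" by simp
    with prob_nonhamiltonian_separated[OF assms True] show ?thesis by (rule order_trans)
  next
    case False
    have "(64 :: real) ^ ?k \<le> (64\<^sup>2) ^ ?k" by (intro power_mono) auto
    then have "2 * (64 ^ ?k * ?e) \<le> 2 * ((64\<^sup>2) ^ ?k * ?e)" by simp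
    with prob_nonhamiltonian_unseparated[OF assms False] show ?thesis by (rule order_trans)
  qed
  then show ?thesis by (simp only: mult.assoc)
qed

end

lemma card_edges_of_hamiltonian_over_cross:
  assumes finite_V: "finite V" and A_subset: "A \<subseteq> V"
    and ham: "hamiltonian V (cross_edges A (V - A) \<union> R)"
  shows "card V \<le> card (R \<inter> all_edges (V - A)) + 2 * card A"
proof -
  let ?B = "V - A"
  obtain c where cycle: "is_cycle (cross_edges A ?B \<union> R) c" "set c = V"
    using ham unfolding hamiltonian_def by blast
  let ?succ = "cycle_of_list c"
  have cycle_props: "distinct c" "3 \<le> length c" using cycle(1) by (auto simp: is_cycle_def)
  have edge: "{v, ?succ v} \<in> cross_edges A ?B \<union> R" if "v \<in> V" for v
    using cycle that by (simp add: is_cycle_iff_cycle_of_list)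
  define T where "T = {v \<in> ?B. ?succ v \<in> ?B}"
  have "card V \<le> card T + 2 * card A"
    using card_le_card_consecutive_outside[of A c] A_subset cycle(2) cycle_props
    by (simp add: T_def distinct_card)
  moreover have "card T \<le> card (R \<inter> all_edges ?B)"
  proof (rule card_inj_on_le)
    show "inj_on (\<lambda>v. {v, ?succ v}) T"
      using inj_on_cycle_edges[OF cycle_props]
      by (rule inj_on_subset) (use cycle(2) in \<open>auto simp: T_def\<close>)
    show "(\<lambda>v. {v, ?succ v}) ` T \<subseteq> R \<inter> all_edges ?B"
    proof (rule image_subsetI)
      fix v assume v_in: "v \<in> T"
      then have "{v, ?succ v} \<notin> cross_edges A ?B"
        by (auto simp: T_def cross_edges_def doubleton_eq_iff)
      moreover have "?succ v \<noteq> v"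
        using v_in cycle(2) cycle_props by (intro cycle_of_list_no_fixpoint) (auto simp: T_def)
      ultimately show "{v, ?succ v} \<in> R \<inter> all_edges ?B"
        using edge[of v] v_in by (auto simp: T_def doubleton_in_all_edges_iff)
    qed
    show "finite (R \<inter> all_edges ?B)" using finite_all_edges[of ?B] finite_V by simp
  qed
  ultimately show ?thesis by linarith
qed

lemma (in random_graph) prob_hamiltonian_over_cross_le:
  assumes small_part: "A \<subseteq> V" "2 * card A < card V"
  shows "prob {R. hamiltonian V (cross_edges A (V - A) \<union> R)}
    \<le> (real (card V))\<^sup>2 * p / (real (card V) - 2 * real (card A))"
proof -
  let ?k = "real (card V) - 2 * real (card A)" and ?S = "all_edges (V - A)"
  have k_pos: "0 < ?k" using small_part(2) by linarith
  have S_subset: "?S \<subseteq> all_edges V" by (rule all_edges_mono) simp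
  have "{R. hamiltonian V (cross_edges A (V - A) \<union> R)} \<subseteq> {R. ?k \<le> real (card (R \<inter> ?S))}"
    using card_edges_of_hamiltonian_over_cross[OF finite_V small_part(1)] by force
  then have "prob {R. hamiltonian V (cross_edges A (V - A) \<union> R)}
      \<le> prob {R. ?k \<le> real (card (R \<inter> ?S))}"
    by (rule prob_mono)
  also have "\<dots> \<le> card ?S * p / ?k" by (rule prob_many_edges_le[OF S_subset k_pos])
  also have "\<dots> \<le> (real (card V))\<^sup>2 * p / ?k"
    using card_all_edges_le[OF finite_V S_subset] k_pos p_ge_0
    by (intro divide_right_mono mult_right_mono) auto
  finally show ?thesis .
qed

lemma min_degree_cross_edges:
  assumes vertices: "finite V" "V \<noteq> {}" and small_part: "A \<subseteq> V" "2 * card A \<le> card V"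
  shows "card A \<le> min_degree V (cross_edges A (V - A))"
proof (rule min_degree_geI)
  show "simple_graph V (cross_edges A (V - A))"
    using vertices small_part cross_edges_subset[of A "V - A" V] by (auto simp: simple_graph_def)
  fix v assume v_in: "v \<in> V"
  show "card A \<le> card (nbrs (cross_edges A (V - A)) v)"
  proof (cases "v \<in> A")
    case True
    then have "nbrs (cross_edges A (V - A)) v = V - A"
      by (auto simp: nbrs_def cross_edges_def doubleton_eq_iff)
    then show ?thesis using small_part vertices by (simp add: card_Diff_subset finite_subset)
  next
    case False
    then have "nbrs (cross_edges A (V - A)) v = A"
      using v_in by (auto simp: nbrs_def cross_edges_def doubleton_eq_iff)
    then show ?thesis by simp
  qed
qed (rule vertices)

lemma prob_union_hamiltonian_cross_tendsto_0:
  fixes d :: "nat \<Rightarrow> nat" and p :: "nat \<Rightarrow> real"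
  assumes small_part: "\<forall>\<^sub>F n in sequentially. 2 * d n < n" and p_bounds: "\<And>n. 0 \<le> p n \<and> p n \<le> 1"
    and small: "p \<in> o(\<lambda>n. (real n - 2 * real (d n)) / (real n)\<^sup>2)"
  shows "(\<lambda>n. prob_union_hamiltonian n (cross_edges {..<d n} {d n..<n}) (p n)) \<longlonglongrightarrow> 0"
proof (rule tendsto_sandwich[OF _ _ tendsto_const])
  let ?scale = "\<lambda>n. (real n - 2 * real (d n)) / (real n)\<^sup>2"
  show "(\<lambda>n. p n / ?scale n) \<longlonglongrightarrow> 0" by (rule smalloD_tendsto[OF small])
  show "\<forall>\<^sub>F n in sequentially. prob_union_hamiltonian n (cross_edges {..<d n} {d n..<n}) (p n)
      \<le> p n / ?scale n"
    using small_part
  proof eventually_elim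
    case (elim n)
    interpret random_graph "{..<n}" "p n" using p_bounds by unfold_locales auto
    show ?case
      using prob_hamiltonian_over_cross_le[of "{..<d n}"] elim
      by (simp add: prob_union_hamiltonian_def mult.commute)
  qed
qed (simp_all add: prob_union_hamiltonian_def)

lemma prob_union_hamiltonian_tendsto_1:
  fixes d :: "nat \<Rightarrow> nat" and p :: "nat \<Rightarrow> real"
  assumes simple: "\<And>n. simple_graph {..<n} (H n)"
    and degree: "\<forall>\<^sub>F n in sequentially. d n \<le> min_degree {..<n} (H n)"
    and d_bounds: "\<forall>\<^sub>F n in sequentially. 31 * n \<le> 64 * d n \<and> 2 * d n < n"
    and p_bounds: "\<And>n. 0 \<le> p n \<and> p n \<le> 1"
    and large: "p \<in> \<omega>(\<lambda>n. (real n - 2 * real (d n)) / (real n)\<^sup>2)"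
  shows "(\<lambda>n. prob_union_hamiltonian n (H n) (p n)) \<longlonglongrightarrow> 1"
proof (rule tendsto_sandwich[OF _ _ _ tendsto_const])
  let ?scale = "\<lambda>n. (real n - 2 * real (d n)) / (real n)\<^sup>2"
  define x where "x = (\<lambda>n. norm (p n / ?scale n))"
  define q where "q = (\<lambda>n. 64\<^sup>2 * exp (- (1 / 64 * x n)))"
  have "\<forall>\<^sub>F n in sequentially. ?scale n \<noteq> 0" using d_bounds by eventually_elim auto
  then have "filterlim x at_top sequentially"
    unfolding x_def by (rule smallomegaD_filterlim_at_top_norm[OF large])
  then have "filterlim (\<lambda>n. 1 / 64 * x n) at_top sequentially"
    by (rule filterlim_tendsto_pos_mult_at_top[OF tendsto_const, rotated]) simp
  then have "(\<lambda>n. exp (- (1 / 64 * x n))) \<longlonglongrightarrow> 0"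
    by (intro filterlim_compose[OF exp_at_bot]) (simp only: filterlim_uminus_at_bot minus_minus)
  then have q_tendsto: "q \<longlonglongrightarrow> 0" unfolding q_def by (rule tendsto_mult_right_zero)
  show "(\<lambda>n. 1 - 2 * q n) \<longlonglongrightarrow> 1"
    using tendsto_diff[OF tendsto_const tendsto_mult_left[OF q_tendsto], of 1 2] by simp
  have "\<forall>\<^sub>F n in sequentially. q n < 1" by (rule order_tendstoD(2)[OF q_tendsto]) simp
  then show "\<forall>\<^sub>F n in sequentially. 1 - 2 * q n \<le> prob_union_hamiltonian n (H n) (p n)"
    using degree d_bounds
  proof eventually_elim
    case (elim n)
    interpret random_graph "{..<n}" "p n" using p_bounds by unfold_locales auto
    let ?k = "n - 2 * d n"
    have k_pos: "0 < ?k" "real ?k = real n - 2 * real (d n)"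
      using elim(3) by (auto simp: of_nat_diff)
    then have "p n * (real n)\<^sup>2 = real ?k * x n"
      using p_bounds[of n] by (simp add: x_def field_simps)
    then have "exp (- p n * (real n)\<^sup>2 / 64) = exp (- (1 / 64 * x n)) ^ ?k"
      by (simp add: exp_of_nat_mult[symmetric])
    moreover have "prob {R. \<not> hamiltonian {..<n} (H n \<union> R)}
        \<le> 2 * (64\<^sup>2) ^ ?k * exp (- p n * (real n)\<^sup>2 / 64)"
      using prob_nonhamiltonian_le[OF simple elim(2)] elim(3) by simp
    ultimately have "prob {R. \<not> hamiltonian {..<n} (H n \<union> R)} \<le> 2 * q n ^ ?k"
      by (simp add: q_def power_mult_distrib)
    also have "q n ^ ?k \<le> q n ^ 1"
      using k_pos(1) elim(1) by (intro power_decreasing) (auto simp: q_def)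
    finally show ?case
      by (simp add: prob_union_hamiltonian_def Collect_neg_eq prob_Compl)
  qed
qed (simp_all add: prob_union_hamiltonian_def)

theorem theorem1p2:
  fixes d :: "nat \<Rightarrow> nat" and \<eta> :: "nat \<Rightarrow> real" and n0 :: nat
  assumes "\<And>n. n \<ge> n0 \<Longrightarrow> real (d n) = real n / 2 - \<eta> n"
    and "\<And>n. n \<ge> n0 \<Longrightarrow> 1 / 2 \<le> \<eta> n \<and> \<eta> n \<le> real n / 64"
  shows "(\<exists>H :: nat \<Rightarrow> nat set set.
            (\<forall>n. simple_graph {..<n} (H n)) \<and>
            (\<forall>n\<ge>n0. min_degree {..<n} (H n) \<ge> d n) \<and>
            (\<forall>p :: nat \<Rightarrow> real. (\<forall>n. 0 \<le> p n \<and> p n \<le> 1) \<longrightarrow>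
               p \<in> o(\<lambda>n. \<eta> n / (real n)\<^sup>2) \<longrightarrow>
               (\<lambda>n. prob_union_hamiltonian n (H n) (p n)) \<longlonglongrightarrow> 0))
       \<and> (\<forall>H :: nat \<Rightarrow> nat set set.
            (\<forall>n. simple_graph {..<n} (H n)) \<longrightarrow>
            (\<forall>n\<ge>n0. min_degree {..<n} (H n) \<ge> d n) \<longrightarrow>
            (\<forall>p :: nat \<Rightarrow> real. (\<forall>n. 0 \<le> p n \<and> p n \<le> 1) \<longrightarrow>
               p \<in> \<omega>(\<lambda>n. \<eta> n / (real n)\<^sup>2) \<longrightarrow>
               (\<lambda>n. prob_union_hamiltonian n (H n) (p n)) \<longlonglongrightarrow> 1))"
proof -
  let ?K = "\<lambda>n. cross_edges {..<d n} {d n..<n}"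
  let ?scale = "\<lambda>n. (real n - 2 * real (d n)) / (real n)\<^sup>2"
  have d_bounds: "31 * n \<le> 64 * d n" "2 * d n < n" if "n \<ge> n0" for n
    using assms[OF that] by linarith+
  then have eventually_d: "\<forall>\<^sub>F n in sequentially. 31 * n \<le> 64 * d n \<and> 2 * d n < n"
    by (auto simp: eventually_at_top_linorder)
  have "\<forall>\<^sub>F n in sequentially. \<eta> n / (real n)\<^sup>2 = (1 / 2) * ?scale n"
    using eventually_ge_at_top[of n0] by eventually_elim (use assms(1) in simp)
  then have scale: "(\<lambda>n. \<eta> n / (real n)\<^sup>2) \<in> \<Theta>(?scale)"
    by (subst landau_theta.cmult[of "1 / 2", symmetric]) (simp, rule bigthetaI_cong)
  show ?thesis
  proof (intro conjI exI[of _ ?K] allI impI)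
    show "simple_graph {..<n} (?K n)" for n
      by (auto simp: simple_graph_def cross_edges_def doubleton_in_all_edges_iff)
    show "d n \<le> min_degree {..<n} (?K n)" if "n \<ge> n0" for n
      using min_degree_cross_edges[of "{..<n}" "{..<d n}"] d_bounds(2)[OF that] by auto
    show "(\<lambda>n. prob_union_hamiltonian n (?K n) (p n)) \<longlonglongrightarrow> 0"
      if "\<forall>n. 0 \<le> p n \<and> p n \<le> 1" "p \<in> o(\<lambda>n. \<eta> n / (real n)\<^sup>2)" for p :: "nat \<Rightarrow> real"
      by (rule prob_union_hamiltonian_cross_tendsto_0)
        (use that eventually_d landau_o.small.cong_bigtheta[OF scale] in
          \<open>auto elim: eventually_mono\<close>)
    show "(\<lambda>n. prob_union_hamiltonian n (H n) (p n)) \<longlonglongrightarrow> 1"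
      if "\<forall>n. simple_graph {..<n} (H n)" "\<forall>n\<ge>n0. d n \<le> min_degree {..<n} (H n)"
        "\<forall>n. 0 \<le> p n \<and> p n \<le> 1" "p \<in> \<omega>(\<lambda>n. \<eta> n / (real n)\<^sup>2)" for H and p :: "nat \<Rightarrow> real"
      by (rule prob_union_hamiltonian_tendsto_1[of H d])
        (use that eventually_d landau_omega.small.cong_bigtheta[OF scale] in
          \<open>auto simp: eventually_at_top_linorder\<close>)
  qed
qed

end
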